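(* Let $0<q<1$ and let $(c,d)$ be an admissible pair: either $d=\bar c\in\mathbb C\setminus\mathbb R$, or $c,d$ are real of the same sign with $q<cd^{-1}<q^{-1}$. Let $a>0$ be an extra parameter, subject, in the case $c,d>0$, to the additional constraint that $aq^m<c,d<aq^{m-1}$ for some $m\in\mathbb Z$. Then for every partition $\lambda$, $$\lim_{a\to0}\Phi^{qM}_\lambda(\,\cdot\,;q;a,c,d)=\Phi^{ASC}_\lambda(\,\cdot\,;q;c,d)$$ (limit over such $a$) in the finite-dimensional space of symmetric functions of degree $\le|\lambda|$, where $\Phi^{qM}_\lambda$ and $\Phi^{ASC}_\lambda$ are the $q$-Meixner and Al-Salam--Carlitz symmetric functions.
   Context: Notation: $(x;q)_n=\prod_{k=0}^{n-1}(1-xq^k)$ for $n\ge0$. $\ell(\lambda)$ is the number of nonzero parts, $|\lambda|=\sum\lambda_i$, $n(\lambda)=\sum_i(i-1)\lambda_i$, $\lambda'$ is the transposed partition (so $n(\lambda')=\sum_i\binom{\lambda_i}2$), $\mathbb Y(N)$ is the set of partitions with at most $N$ nonzero parts. $\mathrm{Sym}$ is the algebra of symmetric functions over $\mathbb C$, $\mathrm{Sym}(N)$ the symmetric polynomials in $N$ variables, the subscript $\le d$ means degree at most $d$. $V(x_1,\dots,x_N)=\prod_{i<j}(x_i-x_j)$. For variables $X=(x_1,x_2,\dots)$, $F(Xc)=F(cx_1,cx_2,\dots)$. Interpolation functions: $(x\mid c_0,c_1,\dots)^m=\prod_{i=0}^{m-1}(x-c_i)$; for $\mu\in\mathbb Y(N)$,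 $s_{\mu|N}(x_1,\dots,x_N\mid c_0,c_1,\dots)=\det[(x_j\mid c_0,c_1,\dots)^{\mu_i+N-i}]_{i,j=1}^N/V(x_1,\dots,x_N)$. $I^A_\mu(\cdot;q)\in\mathrm{Sym}$ is the limit as $N\to\infty$ (which exists) of $s_{\mu|N}(\cdot\mid q^{N-1},q^{N-2},\dots)$, where $F_N\in\mathrm{Sym}(N)$ converges to $F\in\mathrm{Sym}$ if $\sup_N\deg F_N<\infty$ and, for every sufficiently large $d$, $\iota_{d,N}(F_N)\to F$ in $\mathrm{Sym}_{\le d}$; for $N\ge d$, $\iota_{d,N}:\mathrm{Sym}_{\le d}(N)\to\mathrm{Sym}_{\le d}$ is the inverse of the isomorphism $F\mapsto F(x_1,\dots,x_N,0,0,\dots)$. $q$-Meixner symmetric functions: $\Phi^{qM}_\lambda(X;q;a,c,d)=\sum_{\mu\subseteq\lambda}\sigma^{qM}(\lambda,\mu;q;a,c,d)\,I^A_\mu(Xc;q)$ with $$\sigma^{qM}(\lambda,\mu;q;a,c,d)=c^{-|\lambda|}\left(\frac a{qd}\right)^{|\lambda|-|\mu|}q^{2\{n(\mu')-n(\mu)-n(\lambda')+n(\lambda)\}}\det\left[\frac{\left(\frac caq^{\mu_k+2-k};q\right)_{\lambda_j-j-\mu_k+k}}{(q;q)_{\lambda_j-j-\mu_k+k}}\right]_{j,k=1}^{\ell(\lambda)}.$$ Al-Salam--Carlitz symmetric functions: $\Phi^{ASC}_\lambda(X;q;c,d)=\sum_{\mu\subseteq\lambda}\sigma^{ASC}(\lambda,\mu;q;c,d)\,I^A_\mu(Xc;q)$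 with $$\sigma^{ASC}(\lambda,\mu;q;c,d)=c^{-|\lambda|}\left(-\frac cd\right)^{|\lambda|-|\mu|}q^{n(\mu')-n(\mu)-n(\lambda')+n(\lambda)}\det\left[\frac1{(q;q)_{\lambda_j-j-\mu_k+k}}\right]_{j,k=1}^{\ell(\lambda)}.$$ In both determinants an entry with $\lambda_j-j-\mu_k+k<0$ is $0$, and the empty determinant is $1$. *)

theory Defs
  imports
    "HOL-Analysis.Function_Topology"
    "HOL-Library.Poly_Mapping"
    "Jordan_Normal_Form.Determinant"
begin

section \<open>Partitions\<close>

text \<open>
  All indices start at \<open>0\<close>: the part usually written \<open>\<lambda>\<^sub>i\<close> (with \<open>i \<ge> 1\<close>) is \<open>la (i - 1)\<close>.
  Containment of diagrams is the pointwise order \<open>mu \<le> la\<close> on functions.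
\<close>

definition is_partition :: "(nat \<Rightarrow> nat) \<Rightarrow> bool" where
  "is_partition la \<longleftrightarrow> antimono la \<and> finite {i. la i \<noteq> 0}"

definition plen :: "(nat \<Rightarrow> nat) \<Rightarrow> nat" where
  "plen la = card {i. la i \<noteq> 0}"

definition psize :: "(nat \<Rightarrow> nat) \<Rightarrow> nat" where
  "psize la = (\<Sum>i<plen la. la i)"

definition pn :: "(nat \<Rightarrow> nat) \<Rightarrow> nat" where
  "pn la = (\<Sum>i<plen la. i * la i)"

definition transposed :: "(nat \<Rightarrow> nat) \<Rightarrow> nat \<Rightarrow> nat" where
  "transposed la j = card {i. j < la i}"

section \<open>Symmetric polynomials and symmetric functions\<close>

text \<open>
  A monomial in \<open>x\<^sub>0, x\<^sub>1, \<dots>\<close> is its exponent vector. Polynomials are finitely supported maps from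
  monomials to coefficients. Elements of Sym are formal power series of bounded degree, given by
  arbitrary coefficient functions on monomials.
\<close>

type_synonym monom = "nat \<Rightarrow>\<^sub>0 nat"
type_synonym cpoly = "monom \<Rightarrow>\<^sub>0 complex"
type_synonym cseries = "monom \<Rightarrow> complex"

definition mdeg :: "monom \<Rightarrow> nat" where
  "mdeg m = (\<Sum>i\<in>Poly_Mapping.keys m. Poly_Mapping.lookup m i)"

definition Sym_upto :: "nat \<Rightarrow> cseries set" where
  "Sym_upto d = {F. (\<forall>m. F m \<noteq> 0 \<longrightarrow> mdeg m \<le> d) \<and>
     (\<forall>p m. bij p \<longrightarrow> F (Poly_Mapping.map_key p m) = F m)}"

definition SymPoly_upto :: "nat \<Rightarrow> nat \<Rightarrow> cpoly set" where
  "SymPoly_upto N d = {P.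
     (\<forall>m\<in>Poly_Mapping.keys P. Poly_Mapping.keys m \<subseteq> {..<N} \<and> mdeg m \<le> d) \<and>
     (\<forall>p m. p permutes {..<N} \<longrightarrow>
        Poly_Mapping.lookup P (Poly_Mapping.map_key p m) = Poly_Mapping.lookup P m)}"

text \<open>The substitution \<open>F \<mapsto> F(x\<^sub>0, \<dots>, x\<^sub>N\<^sub>-\<^sub>1, 0, 0, \<dots>)\<close>, on coefficients.\<close>

definition restrict_vars :: "nat \<Rightarrow> cseries \<Rightarrow> cseries" where
  "restrict_vars N F = (\<lambda>m. if Poly_Mapping.keys m \<subseteq> {..<N} then F m else 0)"

definition iota :: "nat \<Rightarrow> nat \<Rightarrow> cpoly \<Rightarrow> cseries" where
  "iota d N P = inv_into (Sym_upto d) (restrict_vars N) (Poly_Mapping.lookup P)"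

text \<open>
  The type of coefficient functions carries the topology of pointwise convergence. It is a
  Hausdorff vector space topology, so on the finite-dimensional space \<open>Sym_upto d\<close> it induces the
  unique such topology.
\<close>

abbreviation Sym_top :: "nat \<Rightarrow> cseries topology" where
  "Sym_top d \<equiv> top_of_set (Sym_upto d)"

text \<open>The sequence \<open>G\<close> needs to be meaningful only for large \<open>N\<close>.\<close>

definition sym_converges :: "(nat \<Rightarrow> cpoly) \<Rightarrow> cseries \<Rightarrow> bool" where
  "sym_converges G F \<longleftrightarrow>
     (\<exists>D. \<forall>\<^sub>F N in sequentially. G N \<in> SymPoly_upto N D) \<and>
     (\<forall>\<^sub>F d in sequentially. limitin (Sym_top d) (\<lambda>N. iota d N (G N)) F sequentially)"

definition scale_vars :: "complex \<Rightarrow> cseries \<Rightarrow> cseries" where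
  "scale_vars c F = (\<lambda>m. c ^ mdeg m * F m)"

section \<open>Interpolation functions\<close>

definition pvar :: "nat \<Rightarrow> cpoly" where
  "pvar i = Poly_Mapping.single (Poly_Mapping.single i 1) 1"

definition pconst :: "complex \<Rightarrow> cpoly" where
  "pconst c = Poly_Mapping.single 0 c"

definition shifted_power :: "cpoly \<Rightarrow> (nat \<Rightarrow> complex) \<Rightarrow> nat \<Rightarrow> cpoly" where
  "shifted_power x c m = (\<Prod>i<m. x - pconst (c i))"

definition vandermonde :: "nat \<Rightarrow> cpoly" where
  "vandermonde N = (\<Prod>j<N. \<Prod>i<j. pvar i - pvar j)"

definition interp_schur :: "nat \<Rightarrow> (nat \<Rightarrow> complex) \<Rightarrow> (nat \<Rightarrow> nat) \<Rightarrow> cpoly" where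
  "interp_schur N c mu = (THE P. P * vandermonde N =
     Determinant.det (mat N N (\<lambda>(i, j). shifted_power (pvar j) c (mu i + N - Suc i))))"

definition I_A :: "complex \<Rightarrow> (nat \<Rightarrow> nat) \<Rightarrow> cseries" where
  "I_A q mu = (THE F. sym_converges
     (\<lambda>N. interp_schur N (\<lambda>k. q powi (int N - 1 - int k)) mu) F)"

section \<open>The two families of symmetric functions\<close>

definition qpoch :: "complex \<Rightarrow> complex \<Rightarrow> nat \<Rightarrow> complex" where
  "qpoch x q n = (\<Prod>k<n. 1 - x * q ^ k)"

definition index_gap :: "(nat \<Rightarrow> nat) \<Rightarrow> (nat \<Rightarrow> nat) \<Rightarrow> nat \<Rightarrow> nat \<Rightarrow> int" where
  "index_gap la mu j k = int (la j) - int j - int (mu k) + int k"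

definition n_exponent :: "(nat \<Rightarrow> nat) \<Rightarrow> (nat \<Rightarrow> nat) \<Rightarrow> int" where
  "n_exponent la mu =
     int (pn (transposed mu)) - int (pn mu) - int (pn (transposed la)) + int (pn la)"

text \<open>
  With \<open>k\<close> counted from \<open>0\<close>, the exponent \<open>\<mu>\<^sub>k + 2 - k\<close> becomes \<open>mu k + 1 - k\<close>, while \<^const>\<open>index_gap\<close>
  keeps its form.
\<close>

definition sigma_qM ::
    "(nat \<Rightarrow> nat) \<Rightarrow> (nat \<Rightarrow> nat) \<Rightarrow> complex \<Rightarrow> complex \<Rightarrow> complex \<Rightarrow> complex \<Rightarrow> complex" where
  "sigma_qM la mu q a c d =
     c powi (- int (psize la)) * (a / (q * d)) ^ (psize la - psize mu) *
     q powi (2 * n_exponent la mu) *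
     Determinant.det (mat (plen la) (plen la) (\<lambda>(j, k).
       let n = index_gap la mu j k in
       if n < 0 then 0
       else qpoch (c / a * q powi (int (mu k) + 1 - int k)) q (nat n) / qpoch q q (nat n)))"

definition sigma_ASC ::
    "(nat \<Rightarrow> nat) \<Rightarrow> (nat \<Rightarrow> nat) \<Rightarrow> complex \<Rightarrow> complex \<Rightarrow> complex \<Rightarrow> complex" where
  "sigma_ASC la mu q c d =
     c powi (- int (psize la)) * (- c / d) ^ (psize la - psize mu) *
     q powi (n_exponent la mu) *
     Determinant.det (mat (plen la) (plen la) (\<lambda>(j, k).
       let n = index_gap la mu j k in
       if n < 0 then 0 else 1 / qpoch q q (nat n)))"

definition Phi_qM ::
    "(nat \<Rightarrow> nat) \<Rightarrow> complex \<Rightarrow> complex \<Rightarrow> complex \<Rightarrow> complex \<Rightarrow> cseries" where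
  "Phi_qM la q a c d = (\<lambda>m. \<Sum>mu | is_partition mu \<and> mu \<le> la.
     sigma_qM la mu q a c d * scale_vars c (I_A q mu) m)"

definition Phi_ASC ::
    "(nat \<Rightarrow> nat) \<Rightarrow> complex \<Rightarrow> complex \<Rightarrow> complex \<Rightarrow> cseries" where
  "Phi_ASC la q c d = (\<lambda>m. \<Sum>mu | is_partition mu \<and> mu \<le> la.
     sigma_ASC la mu q c d * scale_vars c (I_A q mu) m)"

section \<open>Admissible parameters\<close>

definition admissible_pair :: "real \<Rightarrow> complex \<Rightarrow> complex \<Rightarrow> bool" where
  "admissible_pair q c d \<longleftrightarrow>
     (c \<notin> \<real> \<and> d = cnj c) \<or>
     (c \<in> \<real> \<and> d \<in> \<real> \<and> Re c * Re d > 0 \<and> q < Re c / Re d \<and> Re c / Re d < 1 / q)"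

definition admissible_a :: "real \<Rightarrow> complex \<Rightarrow> complex \<Rightarrow> real set" where
  "admissible_a q c d = {a. a > 0 \<and>
     (c \<in> \<real> \<and> d \<in> \<real> \<and> Re c > 0 \<and> Re d > 0 \<longrightarrow>
       (\<exists>m::int. a * q powi m < Re c \<and> Re c < a * q powi (m - 1) \<and>
                 a * q powi m < Re d \<and> Re d < a * q powi (m - 1)))}"

end

theory Submission
  imports Defs "HOL-Computational_Algebra.Formal_Power_Series"
begin

text \<open>
  Since \<open>x\<^sub>j\<^sup>n = (\<Sum>s<N. h\<^sub>n\<^sub>-\<^sub>s(x) \<epsilon>\<^sub>s(j))\<close>, where \<open>\<epsilon>\<^sub>s(j)\<close> is the coefficient of \<open>t\<^sup>s\<close> in
  \<open>(\<Prod>l\<noteq>j. 1 - x\<^sub>l t)\<close>, every alternant of shifted powers factors through one fixed matrix, whose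
  determinant is the Vandermonde product. This gives a Jacobi--Trudi formula for the interpolation Schur
  polynomials: a determinant of the fixed size \<open>\<ell>(\<mu>)\<close> in complete symmetric polynomials, with
  coefficients that are elementary symmetric polynomials in a growing finite geometric progression. These
  converge as \<open>N \<rightarrow> \<infinity>\<close>, so the limit defining \<^const>\<open>I_A\<close> exists and has degree at most \<open>|\<mu>|\<close>.

  It remains to let \<open>a \<rightarrow> 0\<close> in the coefficients. In each term of the Leibniz expansion the index gaps
  add up to \<open>|\<lambda>| - |\<mu>|\<close>, so the power of \<open>a\<close> distributes over the factors, and
  \<open>a\<^sup>n (c y / a; q)\<^sub>n \<rightarrow> (\<Prod>k<n. - c y q\<^sup>k)\<close>. The resulting exponent of \<open>q\<close> does not depend on the
  permutation.
\<close>

section \<open>A Jacobi--Trudi formula for shifted powers\<close>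

text \<open>The signed elementary symmetric polynomial
  \<open>(-1)^r e_r(c 0, ..., c (M - 1))\<close>; the recursion splits off the last
  argument.\<close>

fun elem_coeff :: "(nat \<Rightarrow> 'a::comm_ring_1) \<Rightarrow> nat \<Rightarrow> nat \<Rightarrow> 'a" where
  "elem_coeff c 0 r = (if r = 0 then 1 else 0)"
| "elem_coeff c (Suc M) 0 = 1"
| "elem_coeff c (Suc M) (Suc r) = elem_coeff c M (Suc r) - c M * elem_coeff c M r"

lemma elem_coeff_zero [simp]: "elem_coeff c M 0 = 1"
  by (cases M) auto

lemma elem_coeff_eq_0: "M < r \<Longrightarrow> elem_coeff c M r = 0"
  by (induction c M r rule: elem_coeff.induct) auto

lemma prod_diff_eq_elem_coeff:
  fixes x :: "'a::comm_ring_1"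
  shows "(\<Prod>l<M. x - c l) = (\<Sum>r\<le>M. elem_coeff c M r * x ^ (M - r))"
proof (induction M)
  case (Suc M)
  have "(\<Prod>l<Suc M. x - c l) = (\<Sum>r\<le>M. elem_coeff c M r * x ^ (M - r)) * (x - c M)"
    by (simp add: Suc)
  also have "\<dots> = (\<Sum>r\<le>M. elem_coeff c M r * x ^ (Suc M - r))
                 - (\<Sum>r\<le>M. c M * elem_coeff c M r * x ^ (M - r))"
    unfolding right_diff_distrib sum_distrib_right
    by (intro arg_cong2[where f = "(-)"] sum.cong refl) (auto simp: Suc_diff_le algebra_simps)
  also have "(\<Sum>r\<le>M. elem_coeff c M r * x ^ (Suc M - r))
           = (\<Sum>r\<le>Suc M. elem_coeff c M r * x ^ (Suc M - r))"
    by (simp add: elem_coeff_eq_0)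
  also have "\<dots> = x ^ Suc M + (\<Sum>r\<le>M. elem_coeff c M (Suc r) * x ^ (M - r))"
    by (subst sum.atMost_Suc_shift) simp
  also have "\<dots> - (\<Sum>r\<le>M. c M * elem_coeff c M r * x ^ (M - r))
           = x ^ Suc M + (\<Sum>r\<le>M. elem_coeff c (Suc M) (Suc r) * x ^ (M - r))"
    by (simp add: sum_subtractf left_diff_distrib)
  also have "\<dots> = (\<Sum>r\<le>Suc M. elem_coeff c (Suc M) r * x ^ (Suc M - r))"
    by (subst sum.atMost_Suc_shift) simp
  finally show ?case .
qed simp

text \<open>As a polynomial in the formal variable, the product has degree at most
  \<open>card S\<close>.\<close>

lemma fps_nth_prod_linear_eq_0:
  fixes x :: "'b \<Rightarrow> 'a::comm_ring_1"
  assumes "finite S" "card S < s"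
  shows "fps_nth (\<Prod>l\<in>S. 1 - fps_const (x l) * fps_X) s = 0"
  using assms
proof (induction S arbitrary: s rule: finite_induct)
  case (insert l S)
  then obtain s' where s': "s = Suc s'" by (cases s) auto
  have "fps_nth (\<Prod>l\<in>insert l S. 1 - fps_const (x l) * fps_X) s =
        fps_nth (\<Prod>l\<in>S. 1 - fps_const (x l) * fps_X) s
        - x l * fps_nth (\<Prod>l\<in>S. 1 - fps_const (x l) * fps_X) s'"
    using insert.hyps by (simp add: left_diff_distrib s' mult.assoc)
  also have "\<dots> = 0" using insert s' by simp
  finally show ?case .
qed auto

text \<open>The coefficient of \<open>\<epsilon>\<^sub>s(j)\<close> in \<open>(\<Prod>l<M. x\<^sub>j - c\<^sub>l)\<close>, with \<open>h\<close> the complete symmetric functions.\<close>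

definition row_entry :: "(nat \<Rightarrow> 'a::comm_ring_1) \<Rightarrow> (nat \<Rightarrow> 'a) \<Rightarrow> nat \<Rightarrow> nat \<Rightarrow> 'a" where
  "row_entry h c M s = (\<Sum>r\<le>M. if r + s \<le> M then elem_coeff c M r * h (M - r - s) else 0)"

text \<open>The index \<open>s\<close> runs downwards from \<open>N - 1\<close>, so that the matrix
  of row entries is upper triangular whenever row \<open>i\<close> has degree
  \<open>N - 1 - i\<close>.\<close>

definition cofactor_mat :: "(nat \<Rightarrow> 'a::comm_ring_1) \<Rightarrow> nat \<Rightarrow> 'a mat" where
  "cofactor_mat x N = mat N N (\<lambda>(k, j).
     fps_nth (\<Prod>l\<in>{..<N} - {j}. 1 - fps_const (x l) * fps_X) (N - 1 - k))"

text \<open>The relation H(t) E(-t) = 1 of generating functions, which fixes \<open>h\<close> as the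
  complete homogeneous symmetric functions of \<open>x 0, ..., x (N - 1)\<close> without any
  division.\<close>

definition is_complete :: "(nat \<Rightarrow> 'a::comm_ring_1) \<Rightarrow> nat \<Rightarrow> (nat \<Rightarrow> 'a) \<Rightarrow> bool" where
  "is_complete x N h \<longleftrightarrow> Abs_fps h * (\<Prod>l<N. 1 - fps_const (x l) * fps_X) = 1"

text \<open>Compare coefficients of t^n in 1/(1 - x_j t) = H(t) P(t), where P(t) is the product of 1
  - x_l t over l \<noteq> j.\<close>

lemma power_eq_complete_cofactor:
  fixes x :: "nat \<Rightarrow> 'a::comm_ring_1"
  assumes h: "is_complete x N h" and j: "j < N"
  shows "x j ^ n = (\<Sum>s<N. (if s \<le> n then h (n - s) else 0) *
           fps_nth (\<Prod>l\<in>{..<N} - {j}. 1 - fps_const (x l) * fps_X) s)"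
proof -
  define P where "P = (\<Prod>l\<in>{..<N} - {j}. 1 - fps_const (x l) * fps_X)"
  define G where "G = Abs_fps (\<lambda>n. x j ^ n)"
  have G: "G * (1 - fps_const (x j) * fps_X) = 1"
  proof (rule fps_ext)
    fix n
    have eq: "G * (1 - fps_const (x j) * fps_X) = G - fps_const (x j) * (G * fps_X)"
      by (simp only: right_diff_distrib mult_1_right mult.left_commute)
    show "fps_nth (G * (1 - fps_const (x j) * fps_X)) n = fps_nth 1 n"
      unfolding eq by (cases n) (simp_all add: G_def)
  qed
  have "(\<Prod>l<N. 1 - fps_const (x l) * fps_X) = (1 - fps_const (x j) * fps_X) * P"
    unfolding P_def using j by (subst prod.remove[of _ j]) auto
  then have "Abs_fps h * P * (1 - fps_const (x j) * fps_X) = 1"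
    using h by (simp add: is_complete_def mult_ac)
  \<comment> \<open>\<open>Abs_fps h * P\<close> and \<open>G\<close> are both inverse to the same
    linear factor, hence equal.\<close>
  then have "G = G * (Abs_fps h * P * (1 - fps_const (x j) * fps_X))" by (simp only: mult_1_right)
  also have "\<dots> = G * (1 - fps_const (x j) * fps_X) * (Abs_fps h * P)" by (simp only: mult_ac)
  also have "\<dots> = P * Abs_fps h" unfolding G by (simp only: mult_1_left mult.commute)
  finally have "fps_nth G n = fps_nth (P * Abs_fps h) n" by (rule arg_cong)
  then have "x j ^ n = fps_nth (P * Abs_fps h) n" by (simp only: G_def fps_nth_Abs_fps)
  also have "\<dots> = (\<Sum>s\<le>n. h (n - s) * fps_nth P s)"
    by (simp add: fps_mult_nth atLeast0AtMost mult.commute)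
  also have "\<dots> = (\<Sum>s\<in>{..n} \<union> {..<N}. (if s \<le> n then h (n - s) else 0) * fps_nth P s)"
    by (intro sum.mono_neutral_cong_left) auto
  \<comment> \<open>\<open>P\<close> has only \<open>N - 1\<close> factors, so its coefficients
    vanish from \<open>s = N\<close> on.\<close>
  also have "\<dots> = (\<Sum>s<N. (if s \<le> n then h (n - s) else 0) * fps_nth P s)"
  proof (rule sum.mono_neutral_right)
    show "\<forall>s\<in>{..n} \<union> {..<N} - {..<N}. (if s \<le> n then h (n - s) else 0) * fps_nth P s = 0"
    proof
      fix s assume "s \<in> {..n} \<union> {..<N} - {..<N}"
      then have "card ({..<N} - {j}) < s" using j by (subst card_Diff_singleton) auto
      then have "fps_nth P s = 0" unfolding P_def by (intro fps_nth_prod_linear_eq_0) auto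
      then show "(if s \<le> n then h (n - s) else 0) * fps_nth P s = 0" by simp
    qed
  qed auto
  finally show ?thesis by (simp add: P_def)
qed

text \<open>Expanding row \<open>i\<close> in powers of \<open>x j\<close>, and each power by the
  previous lemma, gives coefficients that do not depend on \<open>j\<close>; hence a matrix product.
  Shifts may vary with the row because the Newton polynomials used below do.\<close>

lemma det_shifted_powers:
  fixes x :: "nat \<Rightarrow> 'a::comm_ring_1"
  assumes h: "is_complete x N h"
  shows "det (mat N N (\<lambda>(i, j). \<Prod>l<M i. x j - c i l)) =
         det (mat N N (\<lambda>(i, k). row_entry h (c i) (M i) (N - 1 - k))) * det (cofactor_mat x N)"
proof -
  let ?R = "mat N N (\<lambda>(i, k). row_entry h (c i) (M i) (N - 1 - k))"
  have "mat N N (\<lambda>(i, j). \<Prod>l<M i. x j - c i l) = ?R * cofactor_mat x N"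
  proof (rule eq_matI)
    fix i j assume "i < dim_row (?R * cofactor_mat x N)" "j < dim_col (?R * cofactor_mat x N)"
    then have i: "i < N" and j: "j < N" by (auto simp: cofactor_mat_def)
    let ?e = "\<lambda>s. fps_nth (\<Prod>l\<in>{..<N} - {j}. 1 - fps_const (x l) * fps_X) s"
    have "(\<Prod>l<M i. x j - c i l) =
          (\<Sum>r\<le>M i. elem_coeff (c i) (M i) r * x j ^ (M i - r))"
      by (rule prod_diff_eq_elem_coeff)
    also have "\<dots> = (\<Sum>r\<le>M i. \<Sum>s<N. (if r + s \<le> M i
                  then elem_coeff (c i) (M i) r * h (M i - r - s) else 0) * ?e s)"
      by (subst power_eq_complete_cofactor[OF h j], unfold sum_distrib_left)
         (intro sum.cong refl, auto simp: mult.assoc)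
    also have "\<dots> = (\<Sum>s<N. row_entry h (c i) (M i) s * ?e s)"
      unfolding row_entry_def by (subst sum.swap) (simp add: sum_distrib_right)
    \<comment> \<open>Reverses \<open>s\<close> to match the column order of the two
      factors.\<close>
    also have "\<dots> = (\<Sum>k<N. row_entry h (c i) (M i) (N - 1 - k) * ?e (N - 1 - k))"
      by (rule sum.reindex_bij_witness[of _ "\<lambda>k. N - 1 - k" "\<lambda>k. N - 1 - k"]) auto
    also have "\<dots> = (?R * cofactor_mat x N) $$ (i, j)"
      using i j by (simp add: cofactor_mat_def scalar_prod_def lessThan_atLeast0)
    finally show "mat N N (\<lambda>(i, j). \<Prod>l<M i. x j - c i l) $$ (i, j) = (?R * cofactor_mat x N) $$ (i, j)"
      using i j by simp
  qed (auto simp: cofactor_mat_def)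
  moreover have "cofactor_mat x N \<in> carrier_mat N N" by (simp add: cofactor_mat_def)
  ultimately show ?thesis by (simp add: det_mult[of _ N])
qed

lemma is_complete_0:
  assumes "is_complete x N h"
  shows "h 0 = 1"
proof -
  have "fps_nth (Abs_fps h * (\<Prod>l<N. 1 - fps_const (x l) * fps_X)) 0 = 1"
    using assms by (simp add: is_complete_def)
  moreover have "fps_nth (\<Prod>l<N. 1 - fps_const (x l) * fps_X) 0 = 1"
    by (induction N) auto
  ultimately show ?thesis by simp
qed

lemma row_entry_below:
  assumes "M < s" shows "row_entry h c M s = 0"
  using assms by (simp add: row_entry_def)

lemma row_entry_diag:
  assumes "h 0 = 1" shows "row_entry h c M M = 1"
proof -
  have "row_entry h c M M = (\<Sum>r\<le>M. if r = 0 then 1 else 0)"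
    unfolding row_entry_def by (intro sum.cong) (auto simp: assms)
  then show ?thesis by simp
qed

text \<open>
  The Newton polynomials \<open>(\<Prod>l>i. t - x\<^sub>l)\<close> make the alternant triangular and the matrix of row
  entries unitriangular, so no separate evaluation of the Vandermonde determinant is needed.
\<close>

lemma det_cofactor_mat:
  fixes x :: "nat \<Rightarrow> 'a::comm_ring_1"
  assumes h: "is_complete x N h"
  shows "det (cofactor_mat x N) = (\<Prod>j<N. \<Prod>i<j. x i - x j)"
proof -
  define M where "M = (\<lambda>i. N - 1 - i)"
  define c where "c = (\<lambda>i l. x (i + 1 + l))"
  let ?A = "mat N N (\<lambda>(i, j). \<Prod>l<M i. x j - c i l)"
  let ?R = "mat N N (\<lambda>(i, k). row_entry h (c i) (M i) (N - 1 - k))"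
  have "det ?R = prod_list (diag_mat ?R)"
    by (rule det_upper_triangular[of _ N]) (auto simp: M_def row_entry_below)
  also have "\<dots> = 1"
    using is_complete_0[OF h] by (simp add: prod_list_diag_prod M_def row_entry_diag)
  finally have R: "det ?R = 1" .
  have "det ?A = prod_list (diag_mat ?A)"
  proof (rule det_lower_triangular[of N])
    fix i j assume "i < j" "j < N"
    \<comment> \<open>The factor of row \<open>i\<close> that vanishes at \<open>x j\<close> sits at
      \<open>l = j - i - 1\<close>, because \<open>c i l = x (i + 1 + l)\<close>.\<close>
    then have "\<exists>l\<in>{..<M i}. x j - c i l = 0"
      by (intro bexI[of _ "j - i - 1"]) (auto simp: M_def c_def)
    then show "?A $$ (i, j) = 0" using \<open>i < j\<close> \<open>j < N\<close> by (auto intro!: prod_zero)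
  qed auto
  also have "\<dots> = (\<Prod>i<N. \<Prod>l<M i. x i - c i l)"
    by (simp add: prod_list_diag_prod lessThan_atLeast0)
  also have "\<dots> = (\<Prod>i<N. \<Prod>j\<in>{i<..<N}. x i - x j)"
  proof (rule prod.cong[OF refl])
    fix i assume "i \<in> {..<N}"
    then show "(\<Prod>l<M i. x i - c i l) = (\<Prod>j\<in>{i<..<N}. x i - x j)"
      by (intro prod.reindex_bij_witness[of _ "\<lambda>j. j - i - 1" "\<lambda>l. i + 1 + l"])
         (auto simp: M_def c_def)
  qed
  also have "\<dots> = (\<Prod>(i, j)\<in>(SIGMA i:{..<N}. {i<..<N}). x i - x j)"
    by (simp add: prod.Sigma)
  also have "\<dots> = (\<Prod>(j, i)\<in>(SIGMA j:{..<N}. {..<j}). x i - x j)"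
    by (rule prod.reindex_bij_witness[of _ prod.swap prod.swap]) auto
  also have "\<dots> = (\<Prod>j<N. \<Prod>i<j. x i - x j)"
    by (simp add: prod.Sigma)
  finally show ?thesis
    using det_shifted_powers[OF h, where M = M and c = c] R by (metis mult_1)
qed

text \<open>Rows from \<open>L\<close> on have staircase degree, so the lower left block vanishes
  and the lower right one is unitriangular. What remains has a size independent of
  \<open>N\<close>.\<close>

lemma det_row_entry_reduce:
  fixes h :: "nat \<Rightarrow> 'a::idom"
  assumes h0: "h 0 = 1" and L: "L \<le> N"
    and M: "\<And>i. L \<le> i \<Longrightarrow> i < N \<Longrightarrow> M i = N - 1 - i"
  shows "det (mat N N (\<lambda>(i, k). row_entry h (c i) (M i) (N - 1 - k))) =
         det (mat L L (\<lambda>(i, k). row_entry h (c i) (M i) (N - 1 - k)))"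
proof -
  let ?f = "\<lambda>i k. row_entry h (c i) (M i) (N - 1 - k)"
  let ?A4 = "mat (N - L) (N - L) (\<lambda>(i, k). ?f (i + L) (k + L))"
  have eq: "mat N N (\<lambda>(i, k). ?f i k) = four_block_mat (mat L L (\<lambda>(i, k). ?f i k))
      (mat L (N - L) (\<lambda>(i, k). ?f i (k + L))) (0\<^sub>m (N - L) L) ?A4"
  proof (rule eq_matI)
    fix i j assume "i < dim_row (four_block_mat (mat L L (\<lambda>(i, k). ?f i k))
      (mat L (N - L) (\<lambda>(i, k). ?f i (k + L))) (0\<^sub>m (N - L) L) ?A4)"
      "j < dim_col (four_block_mat (mat L L (\<lambda>(i, k). ?f i k))
      (mat L (N - L) (\<lambda>(i, k). ?f i (k + L))) (0\<^sub>m (N - L) L) ?A4)"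
    then have "i < N" "j < N" using L by auto
    then show "mat N N (\<lambda>(i, k). ?f i k) $$ (i, j) = four_block_mat (mat L L (\<lambda>(i, k). ?f i k))
      (mat L (N - L) (\<lambda>(i, k). ?f i (k + L))) (0\<^sub>m (N - L) L) ?A4 $$ (i, j)"
      using M[of i] by (auto simp: row_entry_below)
  qed (use L in auto)
  have "det ?A4 = prod_list (diag_mat ?A4)"
    by (rule det_upper_triangular[of _ "N - L"]) (auto simp: M row_entry_below)
  also have "\<dots> = 1" by (simp add: prod_list_diag_prod M row_entry_diag h0)
  finally have A4: "det ?A4 = 1" .
  show ?thesis unfolding eq
    by (subst det_four_block_mat_lower_left_zero[of _ L _ "N - L"]) (use A4 in simp_all)
qed

lemma det_leibniz:
  "det (mat L L (\<lambda>(i, k). f i k)) =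
    (\<Sum>p | p permutes {..<L}. of_int (sign p) * (\<Prod>i<L. f i (p i)))"
  by (subst det_def'[of _ L])
     (auto intro!: sum.cong arg_cong2[where f = "(*)"] prod.cong
        simp: lessThan_atLeast0 permutes_in_image)

section \<open>Convergence in Sym\<close>

text \<open>The topology on coefficient functions is the product topology, so limits can be taken
  one coefficient at a time.\<close>

lemma limitin_Sym_top:
  "limitin (Sym_top d) f F net \<longleftrightarrow>
     F \<in> Sym_upto d \<and> (\<forall>\<^sub>F x in net. f x \<in> Sym_upto d) \<and> (\<forall>m. ((\<lambda>x. f x m) \<longlongrightarrow> F m) net)"
  unfolding limitin_subtopology euclidean_product_topology[symmetric] limitin_componentwise
  by simp

section \<open>Lifting symmetric polynomials to symmetric functions\<close>

lemma lookup_map_key: "inj p \<Longrightarrow> Poly_Mapping.lookup (Poly_Mapping.map_key p m) i = Poly_Mapping.lookup m (p i)"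
  by (simp add: Poly_Mapping.map_key.rep_eq)

text \<open>The complements of \<open>A\<close> and \<open>B\<close> in \<open>S\<close> have equal
  size, so \<open>f\<close> can be glued to a bijection between them.\<close>

lemma permutes_extending_bij_betw:
  assumes "finite S" "A \<subseteq> S" "B \<subseteq> S" and f: "bij_betw f A B"
  obtains p where "p permutes S" "\<And>a. a \<in> A \<Longrightarrow> p a = f a"
proof -
  have "finite A" "finite B" using assms finite_subset by blast+
  then have "card (S - A) = card (S - B)"
    using assms bij_betw_same_card[OF f] by (simp add: card_Diff_subset)
  then obtain g where g: "bij_betw g (S - A) (S - B)"
    using \<open>finite S\<close> finite_same_card_bij by blast
  let ?h = "\<lambda>x. if x \<in> A then f x else g x"
  have "bij_betw ?h A B" using f by (rule bij_betw_cong[THEN iffD1, rotated]) simp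
  moreover have "bij_betw ?h (S - A) (S - B)"
    using g by (rule bij_betw_cong[THEN iffD1, rotated]) simp
  ultimately have "bij_betw ?h (A \<union> (S - A)) (B \<union> (S - B))"
    by (rule bij_betw_combine) auto
  moreover have "A \<union> (S - A) = S" "B \<union> (S - B) = S" using assms by auto
  ultimately have h: "bij_betw ?h S S" by simp
  define p where "p = (\<lambda>x. if x \<in> S then ?h x else x)"
  have "bij_betw p S S" using h by (rule bij_betw_cong[THEN iffD1, rotated]) (simp add: p_def)
  then have "p permutes S" by (rule bij_imp_permutes) (simp add: p_def)
  moreover have "p a = f a" if "a \<in> A" for a using that assms by (auto simp: p_def)
  ultimately show thesis by (rule that)
qed

lemma card_keys_le_mdeg: "card (Poly_Mapping.keys m) \<le> mdeg m"
proof -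
  have "(\<Sum>i\<in>Poly_Mapping.keys m. 1) \<le> mdeg m"
    unfolding mdeg_def by (intro sum_mono) (simp add: in_keys_iff Suc_leI)
  then show ?thesis by simp
qed

lemma mdeg_map_key:
  assumes "bij p" shows "mdeg (Poly_Mapping.map_key p m) = mdeg m"
proof -
  have "inj p" using assms by (rule bij_is_inj)
  have "(\<Sum>i\<in>p -` Poly_Mapping.keys m. Poly_Mapping.lookup m (p i)) =
        (\<Sum>i\<in>Poly_Mapping.keys m. Poly_Mapping.lookup m i)"
    using assms by (intro sum.reindex_bij_witness[of _ "inv_into UNIV p" p])
      (auto simp: bij_is_inj bij_is_surj surj_f_inv_f)
  then show ?thesis using \<open>inj p\<close> by (simp add: mdeg_def keys_map_key lookup_map_key)
qed

text \<open>A monomial of degree at most \<open>N\<close> involves at most \<open>N\<close>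
  variables, so these can be renamed to initial ones.\<close>

lemma exists_map_key_keys_subset:
  assumes "mdeg m \<le> N"
  obtains p where "bij p" "Poly_Mapping.keys (Poly_Mapping.map_key p m) \<subseteq> {..<N}"
proof -
  let ?K = "Poly_Mapping.keys m"
  let ?B = "{..<card ?K}"
  have le: "card ?K \<le> N" using card_keys_le_mdeg[of m] assms by simp
  obtain f where f: "bij_betw f ?B ?K"
    using finite_same_card_bij[of ?B ?K] by auto
  \<comment> \<open>\<open>map_key p\<close> pulls exponents back along \<open>p\<close>, so
    \<open>p\<close> has to send an initial segment onto the variables of \<open>m\<close>.\<close>
  obtain p where p: "p permutes (?B \<union> ?K)" "\<And>a. a \<in> ?B \<Longrightarrow> p a = f a"
    using permutes_extending_bij_betw[OF _ _ _ f, of "?B \<union> ?K"] by auto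
  have "bij p" using p(1) by (rule permutes_bij)
  have "p ` ?B = ?K" using f p(2) by (simp add: bij_betw_def)
  then have "p -` ?K = ?B" using \<open>bij p\<close> by (metis bij_is_inj inj_vimage_image_eq)
  then have "Poly_Mapping.keys (Poly_Mapping.map_key p m) = ?B"
    using \<open>bij p\<close> by (simp add: keys_map_key bij_is_inj)
  then show thesis using that \<open>bij p\<close> le by auto
qed

text \<open>Bridges two notions of symmetry: \<open>Sym_upto\<close> refers to all bijections,
  \<open>SymPoly_upto\<close> to permutations of the first \<open>N\<close> indices. Only the values
  of \<open>p\<close> on the preimage of the variables of \<open>m\<close> matter, and these extend
  to such a permutation.\<close>

lemma map_key_eq_permutes:
  fixes m :: monom
  assumes "bij p" "Poly_Mapping.keys m \<subseteq> {..<N}" "Poly_Mapping.keys (Poly_Mapping.map_key p m) \<subseteq> {..<N}"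
  obtains p' where "p' permutes {..<N}" "Poly_Mapping.map_key p' m = Poly_Mapping.map_key p m"
proof -
  let ?K = "Poly_Mapping.keys m"
  let ?A = "p -` ?K"
  have "inj p" using assms(1) by (rule bij_is_inj)
  have A: "?A \<subseteq> {..<N}" using assms(3) \<open>inj p\<close> by (simp add: keys_map_key)
  have f: "bij_betw p ?A ?K"
    using assms(1) by (auto simp: bij_betw_def inj_on_def surj_image_vimage_eq dest: injD)
  then obtain p' where p': "p' permutes {..<N}" "\<And>a. a \<in> ?A \<Longrightarrow> p' a = p a"
    using permutes_extending_bij_betw[OF finite_lessThan A assms(2) f] by blast
  have "inj p'" using p'(1) by (rule permutes_inj)
  have "p' ` ?A = p ` ?A" by (intro image_cong) (auto simp: p'(2))
  also have "\<dots> = ?K" using assms(1) by (simp add: surj_image_vimage_eq bij_is_surj)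
  finally have im: "p' ` ?A = ?K" .
  have "Poly_Mapping.lookup m (p' i) = Poly_Mapping.lookup m (p i)" for i
  proof (cases "i \<in> ?A")
    \<comment> \<open>Off the preimage both exponents are \<open>0\<close>: \<open>p'\<close> is
      injective and already reaches every variable of \<open>m\<close> from
      \<open>?A\<close>.\<close>
    case False
    then have "p' i \<notin> p' ` ?A" by (simp add: inj_image_mem_iff[OF \<open>inj p'\<close>])
    then have "p' i \<notin> ?K" unfolding im .
    moreover have "p i \<notin> ?K" using False by simp
    ultimately show ?thesis by (simp add: in_keys_iff)
  qed (simp add: p'(2))
  then have "Poly_Mapping.map_key p' m = Poly_Mapping.map_key p m"
    using \<open>inj p\<close> \<open>inj p'\<close> by (intro poly_mapping_eqI) (simp add: lookup_map_key)
  then show thesis using that p'(1) by blast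
qed

text \<open>Surjectivity of the restriction map: a coefficient of the lift is read off after
  renaming the variables of its monomial into the first \<open>N\<close>, and the symmetry of
  \<open>P\<close> makes the result independent of the renaming.\<close>

lemma SymPoly_upto_lift:
  assumes P: "P \<in> SymPoly_upto N d" and "d \<le> N"
  shows "Poly_Mapping.lookup P \<in> restrict_vars N ` Sym_upto d"
proof -
  let ?mk = "Poly_Mapping.map_key"
  define good where "good = (\<lambda>(m::monom) (p::nat \<Rightarrow> nat). bij p \<and> Poly_Mapping.keys (?mk p m) \<subseteq> {..<N})"
  define r where "r = (\<lambda>m. SOME p. good m p)"
  have r: "good m (r m)" if "mdeg m \<le> d" for m
  proof -
    have "mdeg m \<le> N" using that \<open>d \<le> N\<close> by simp
    then obtain p where "bij p" "Poly_Mapping.keys (?mk p m) \<subseteq> {..<N}"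
      by (rule exists_map_key_keys_subset)
    then have "good m p" by (simp add: good_def)
    then show ?thesis unfolding r_def by (rule someI[of "good m"])
  qed
  define F where "F = (\<lambda>m. if mdeg m \<le> d then Poly_Mapping.lookup P (?mk (r m) m) else 0)"
  have inv: "Poly_Mapping.lookup P (?mk p m) = Poly_Mapping.lookup P m"
    if "good m p" "Poly_Mapping.keys m \<subseteq> {..<N}" for m p
  proof -
    from that obtain p' where "p' permutes {..<N}" "?mk p' m = ?mk p m"
      unfolding good_def using map_key_eq_permutes by metis
    moreover have "Poly_Mapping.lookup P (?mk p' m) = Poly_Mapping.lookup P m"
      using P \<open>p' permutes {..<N}\<close> unfolding SymPoly_upto_def by blast
    ultimately show ?thesis by simp
  qed
  have "F \<in> Sym_upto d"
    unfolding Sym_upto_def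
  proof (intro CollectI conjI allI impI)
    fix m assume "F m \<noteq> 0" then show "mdeg m \<le> d" by (auto simp: F_def split: if_splits)
  next
    fix p :: "nat \<Rightarrow> nat" and m assume p: "bij p"
    show "F (?mk p m) = F m"
    proof (cases "mdeg m \<le> d")
      case True
      let ?m' = "?mk p m" and ?s = "r m" and ?s' = "r (?mk p m)"
      have s: "bij ?s" "Poly_Mapping.keys (?mk ?s m) \<subseteq> {..<N}" using r[OF True] by (auto simp: good_def)
      have s': "bij ?s'" "Poly_Mapping.keys (?mk ?s' ?m') \<subseteq> {..<N}"
        using r[of ?m'] True p by (auto simp: good_def mdeg_map_key)
      \<comment> \<open>The transition between the renamings chosen for \<open>m\<close> and for its
        image under \<open>p\<close>.\<close>
      define t where "t = inv_into UNIV ?s \<circ> p \<circ> ?s'"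
      have t: "bij t" unfolding t_def using s(1) s'(1) p by (intro bij_comp bij_imp_bij_inv)
      have "?s (t i) = p (?s' i)" for i
        using s(1) by (simp add: t_def bij_is_surj surj_f_inv_f)
      then have eq: "?mk t (?mk ?s m) = ?mk ?s' ?m'"
        using t s(1) s'(1) p by (intro poly_mapping_eqI) (simp add: lookup_map_key bij_is_inj)
      have "Poly_Mapping.lookup P (?mk t (?mk ?s m)) = Poly_Mapping.lookup P (?mk ?s m)"
        by (rule inv) (use s s' t in \<open>auto simp: good_def eq\<close>)
      then show ?thesis using True p by (simp add: F_def mdeg_map_key eq)
    qed (simp add: F_def mdeg_map_key p)
  qed
  moreover have "restrict_vars N F = Poly_Mapping.lookup P"
  proof
    fix m
    show "restrict_vars N F m = Poly_Mapping.lookup P m"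
    proof (cases "m \<in> Poly_Mapping.keys P")
      case True
      then have "Poly_Mapping.keys m \<subseteq> {..<N}" "mdeg m \<le> d" using P by (auto simp: SymPoly_upto_def)
      then show ?thesis using inv r by (simp add: restrict_vars_def F_def)
    next
      case False
      then have "Poly_Mapping.lookup P m = 0" by (simp add: in_keys_iff)
      then show ?thesis using inv[OF r, of m] by (auto simp: restrict_vars_def F_def)
    qed
  qed
  ultimately show ?thesis by (metis imageI)
qed

lemma
  assumes "P \<in> SymPoly_upto N d" "d \<le> N"
  shows iota_in_Sym_upto: "iota d N P \<in> Sym_upto d"
    and restrict_vars_iota: "restrict_vars N (iota d N P) = Poly_Mapping.lookup P"
  using SymPoly_upto_lift[OF assms] unfolding iota_def
  by (rule inv_into_into, rule f_inv_into_f)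

section \<open>Closedness, uniqueness and existence of limits\<close>

lemma Sym_upto_mono: "d \<le> d' \<Longrightarrow> Sym_upto d \<subseteq> Sym_upto d'"
  unfolding Sym_upto_def by (blast intro: le_trans)

lemma SymPoly_upto_mono: "d \<le> d' \<Longrightarrow> SymPoly_upto N d \<subseteq> SymPoly_upto N d'"
  unfolding SymPoly_upto_def by (blast intro: le_trans)

text \<open>Degree bound and symmetry say that some coefficients vanish and others agree; both
  survive coefficientwise limits.\<close>

lemma Sym_upto_closed:
  assumes ev: "\<forall>\<^sub>F x in net. f x \<in> Sym_upto d" and lim: "\<And>m. ((\<lambda>x. f x m) \<longlongrightarrow> F m) net"
    and net: "net \<noteq> bot"
  shows "F \<in> Sym_upto d"
  unfolding Sym_upto_def
proof (intro CollectI conjI allI impI)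
  fix m assume "F m \<noteq> 0"
  show "mdeg m \<le> d"
  proof (rule ccontr)
    assume "\<not> mdeg m \<le> d"
    then have "\<forall>\<^sub>F x in net. f x m = 0" using ev by (auto simp: Sym_upto_def elim!: eventually_mono)
    then have "((\<lambda>x. f x m) \<longlongrightarrow> 0) net" by (rule tendsto_eventually)
    with lim[of m] net have "F m = 0" using tendsto_unique by blast
    with \<open>F m \<noteq> 0\<close> show False by simp
  qed
next
  fix p :: "nat \<Rightarrow> nat" and m assume "bij p"
  then have "\<forall>\<^sub>F x in net. f x (Poly_Mapping.map_key p m) = f x m"
    using ev by (auto simp: Sym_upto_def elim!: eventually_mono)
  then have "((\<lambda>x. f x m) \<longlongrightarrow> F (Poly_Mapping.map_key p m)) net"
    using lim[of "Poly_Mapping.map_key p m"] by (rule tendsto_cong[THEN iffD1])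
  then show "F (Poly_Mapping.map_key p m) = F m" using lim[of m] net tendsto_unique by blast
qed

text \<open>Makes the \<open>THE\<close> in \<open>I_A\<close> determinate. Both limits can be
  compared in one common degree \<open>d\<close>.\<close>

lemma sym_converges_unique:
  assumes "sym_converges G F" "sym_converges G F'"
  shows "F = F'"
proof -
  have "\<forall>\<^sub>F d in sequentially. limitin (Sym_top d) (\<lambda>N. iota d N (G N)) F sequentially \<and>
     limitin (Sym_top d) (\<lambda>N. iota d N (G N)) F' sequentially"
    using assms by (auto simp: sym_converges_def intro: eventually_conj)
  then obtain d where "limitin (Sym_top d) (\<lambda>N. iota d N (G N)) F sequentially"
     "limitin (Sym_top d) (\<lambda>N. iota d N (G N)) F' sequentially"
    using eventually_happens' sequentially_bot by blast
  then show ?thesis unfolding limitin_Sym_top by (intro ext) (blast intro: LIMSEQ_unique)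
qed

text \<open>Once \<open>N\<close> exceeds every variable of \<open>m\<close>, the lift has the same
  coefficient at \<open>m\<close> as \<open>G N\<close>, so coefficientwise convergence of the
  polynomials suffices.\<close>

lemma sym_converges_lim:
  assumes ev: "\<forall>\<^sub>F N in sequentially. G N \<in> SymPoly_upto N D"
    and conv: "\<And>m. convergent (\<lambda>N. Poly_Mapping.lookup (G N) m)"
  defines "F \<equiv> \<lambda>m. lim (\<lambda>N. Poly_Mapping.lookup (G N) m)"
  shows "F \<in> Sym_upto D" "sym_converges G F"
proof -
  have *: "\<forall>\<^sub>F N in sequentially. iota d N (G N) \<in> Sym_upto d"
          "(\<lambda>N. iota d N (G N) m) \<longlonglongrightarrow> F m" if "D \<le> d" for d m
  proof -
    have ev': "\<forall>\<^sub>F N in sequentially. G N \<in> SymPoly_upto N d \<and> d \<le> N"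
      using ev eventually_ge_at_top[of d] by eventually_elim (use SymPoly_upto_mono[OF that] in auto)
    then show "\<forall>\<^sub>F N in sequentially. iota d N (G N) \<in> Sym_upto d"
      by eventually_elim (auto intro: iota_in_Sym_upto)
    have "\<exists>K. Poly_Mapping.keys m \<subseteq> {..<K}"
      using finite_nat_iff_bounded[of "Poly_Mapping.keys m"] by simp
    then obtain K where K: "Poly_Mapping.keys m \<subseteq> {..<K}" by blast
    have "\<forall>\<^sub>F N in sequentially. Poly_Mapping.lookup (G N) m = iota d N (G N) m"
      using ev' eventually_ge_at_top[of K]
    proof eventually_elim
      case (elim N)
      then have "restrict_vars N (iota d N (G N)) m = Poly_Mapping.lookup (G N) m"
        by (simp add: restrict_vars_iota)
      moreover have "Poly_Mapping.keys m \<subseteq> {..<N}" using K elim by force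
      ultimately show ?case by (simp add: restrict_vars_def)
    qed
    moreover have "(\<lambda>N. Poly_Mapping.lookup (G N) m) \<longlonglongrightarrow> F m"
      using conv[of m] by (simp add: F_def convergent_LIMSEQ_iff)
    ultimately show "(\<lambda>N. iota d N (G N) m) \<longlonglongrightarrow> F m"
      by (rule tendsto_cong[THEN iffD1])
  qed
  have F: "F \<in> Sym_upto d" if "D \<le> d" for d
    using *[OF that] by (intro Sym_upto_closed[where net = sequentially]) auto
  then show "F \<in> Sym_upto D" by simp
  have "\<forall>\<^sub>F d in sequentially. limitin (Sym_top d) (\<lambda>N. iota d N (G N)) F sequentially"
    using eventually_ge_at_top[of D] by eventually_elim (simp add: limitin_Sym_top F *)
  with ev show "sym_converges G F" by (auto simp: sym_converges_def)
qed

section \<open>Degrees, symmetry and coefficientwise convergence of polynomials\<close>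

lemma mdeg_eq_sum:
  assumes "finite S" "Poly_Mapping.keys m \<subseteq> S"
  shows "mdeg m = (\<Sum>i\<in>S. Poly_Mapping.lookup m i)"
  unfolding mdeg_def using assms by (intro sum.mono_neutral_left) (auto simp: in_keys_iff)

lemma mdeg_add: "mdeg (a + b) = mdeg a + mdeg b"
proof -
  let ?S = "Poly_Mapping.keys a \<union> Poly_Mapping.keys b"
  have "mdeg (a + b) = (\<Sum>i\<in>?S. Poly_Mapping.lookup (a + b) i)"
    using keys_add[of a b] by (intro mdeg_eq_sum) auto
  also have "\<dots> = mdeg a + mdeg b"
    by (simp add: lookup_add sum.distrib mdeg_eq_sum[of ?S a] mdeg_eq_sum[of ?S b])
  finally show ?thesis .
qed

lemma mdeg_0 [simp]: "mdeg 0 = 0"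
  by (simp add: mdeg_def)

lemma mdeg_single [simp]: "mdeg (Poly_Mapping.single i n) = n"
  by (simp add: mdeg_def)

lemma mdeg_eq_0_iff [simp]: "mdeg m = 0 \<longleftrightarrow> m = 0"
proof
  assume "mdeg m = 0"
  then have "card (Poly_Mapping.keys m) = 0" using card_keys_le_mdeg[of m] by simp
  then show "m = 0" by simp
qed simp

lemma lookup_le_mdeg: "Poly_Mapping.lookup m i \<le> mdeg m"
proof (cases "i \<in> Poly_Mapping.keys m")
  case True
  then show ?thesis unfolding mdeg_def by (intro member_le_sum) auto
qed (simp add: in_keys_iff)

lemma finite_bounded_monoms:
  assumes "finite S"
  shows "finite {a::monom. Poly_Mapping.keys a \<subseteq> S \<and> mdeg a \<le> n}"
proof (rule finite_imageD)
  show "finite (Poly_Mapping.lookup ` {a::monom. Poly_Mapping.keys a \<subseteq> S \<and> mdeg a \<le> n})"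
  proof (rule finite_subset)
    show "Poly_Mapping.lookup ` {a::monom. Poly_Mapping.keys a \<subseteq> S \<and> mdeg a \<le> n} \<subseteq>
      {f. \<forall>i. (i \<in> S \<longrightarrow> f i \<in> {..n}) \<and> (i \<notin> S \<longrightarrow> f i = 0)}"
      by (auto simp: in_keys_iff intro: le_trans[OF lookup_le_mdeg])
    show "finite {f. \<forall>i. (i \<in> S \<longrightarrow> f i \<in> {..n}) \<and> (i \<notin> S \<longrightarrow> f i = 0)}"
      using assms by (rule finite_set_of_finite_funs) simp
  qed
  show "inj_on Poly_Mapping.lookup {a::monom. Poly_Mapping.keys a \<subseteq> S \<and> mdeg a \<le> n}"
    by (rule inj_onI, rule poly_mapping_eqI, rule fun_cong)
qed

lemma keys_add_nat: "Poly_Mapping.keys (a + b :: monom) = Poly_Mapping.keys a \<union> Poly_Mapping.keys b"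
  by (auto simp: in_keys_iff lookup_add)

definition splits :: "monom \<Rightarrow> (monom \<times> monom) set" where
  "splits m = {(a, b). a + b = m}"

lemma finite_splits: "finite (splits m)"
proof (rule finite_subset)
  let ?B = "{a::monom. Poly_Mapping.keys a \<subseteq> Poly_Mapping.keys m \<and> mdeg a \<le> mdeg m}"
  show "splits m \<subseteq> ?B \<times> ?B" by (auto simp: splits_def keys_add_nat mdeg_add)
  show "finite (?B \<times> ?B)" using finite_bounded_monoms[of "Poly_Mapping.keys m"] by simp
qed

text \<open>Writes the convolution over a finite index set depending only on \<open>m\<close>, so
  that limits and symmetry pass through products.\<close>

lemma lookup_mult_splits:
  fixes P Q :: cpoly
  shows "Poly_Mapping.lookup (P * Q) m =
    (\<Sum>(a, b)\<in>splits m. Poly_Mapping.lookup P a * Poly_Mapping.lookup Q b)"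
proof -
  have "Poly_Mapping.lookup (P * Q) m =
    (\<Sum>(a, b). Poly_Mapping.lookup P a * Poly_Mapping.lookup Q b when m = a + b)"
    unfolding times_poly_mapping.rep_eq by (rule prod_fun_unfold_prod) simp_all
  also have "\<dots> = (\<Sum>(a, b)\<in>splits m. Poly_Mapping.lookup P a * Poly_Mapping.lookup Q b when m = a + b)"
    by (rule Sum_any.expand_superset[OF finite_splits]) (auto simp: splits_def when_def split: if_splits)
  also have "\<dots> = (\<Sum>(a, b)\<in>splits m. Poly_Mapping.lookup P a * Poly_Mapping.lookup Q b)"
    by (intro sum.cong) (auto simp: splits_def)
  finally show ?thesis .
qed

text \<open>
  The degree bound is an integer because a Jacobi--Trudi entry of negative degree is \<open>0\<close>; the bounds
  then add up to \<open>|\<mu>|\<close> along every permutation.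
\<close>

definition sym_poly_le :: "nat \<Rightarrow> int \<Rightarrow> cpoly \<Rightarrow> bool" where
  "sym_poly_le N D P \<longleftrightarrow>
     (\<forall>m. Poly_Mapping.lookup P m \<noteq> 0 \<longrightarrow> Poly_Mapping.keys m \<subseteq> {..<N} \<and> int (mdeg m) \<le> D) \<and>
     (\<forall>p m. p permutes {..<N} \<longrightarrow>
        Poly_Mapping.lookup P (Poly_Mapping.map_key p m) = Poly_Mapping.lookup P m)"

lemma sym_poly_le_nat: "sym_poly_le N (int D) P \<longleftrightarrow> P \<in> SymPoly_upto N D"
  by (simp add: sym_poly_le_def SymPoly_upto_def in_keys_iff Ball_def)

lemma sym_poly_le_mono: "sym_poly_le N D P \<Longrightarrow> D \<le> D' \<Longrightarrow> sym_poly_le N D' P"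
  unfolding sym_poly_le_def by (blast intro: order_trans)

lemma sym_poly_le_0 [simp]: "sym_poly_le N D 0"
  by (simp add: sym_poly_le_def)

lemma sym_poly_le_add:
  "sym_poly_le N D P \<Longrightarrow> sym_poly_le N D Q \<Longrightarrow> sym_poly_le N D (P + Q)"
  unfolding sym_poly_le_def lookup_add by (metis add.right_neutral)

lemma sym_poly_le_uminus: "sym_poly_le N D P \<Longrightarrow> sym_poly_le N D (- P)"
  by (simp add: sym_poly_le_def)

lemma sym_poly_le_sum:
  "(\<And>i. i \<in> S \<Longrightarrow> sym_poly_le N D (f i)) \<Longrightarrow> sym_poly_le N D (sum f S)"
  by (induction S rule: infinite_finite_induct) (auto intro: sym_poly_le_add)

lemma map_key_eq_0_iff:
  fixes p :: "nat \<Rightarrow> nat"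
  assumes "bij p" shows "Poly_Mapping.map_key p m = 0 \<longleftrightarrow> (m::monom) = 0"
  by (simp only: mdeg_eq_0_iff[symmetric] mdeg_map_key[OF assms])

lemma sym_poly_le_pconst: "D \<ge> 0 \<Longrightarrow> sym_poly_le N D (pconst c)"
  by (auto simp: sym_poly_le_def pconst_def lookup_single when_def
      map_key_eq_0_iff[OF permutes_bij] eq_commute[of 0])

lemma map_key_inv:
  assumes "bij p"
  shows "Poly_Mapping.map_key p (Poly_Mapping.map_key (inv_into UNIV p) m) = m"
proof -
  have "inj p" "inj (inv_into UNIV p)" using assms by (auto simp: bij_is_inj bij_imp_bij_inv)
  then show ?thesis
    by (intro poly_mapping_eqI) (simp add: lookup_map_key)
qed

lemma map_key_inv':
  assumes "bij p"
  shows "Poly_Mapping.map_key (inv_into UNIV p) (Poly_Mapping.map_key p m) = m"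
proof -
  have "inj p" "inj (inv_into UNIV p)" using assms by (auto simp: bij_is_inj bij_imp_bij_inv)
  then show ?thesis
    using assms by (intro poly_mapping_eqI) (simp add: lookup_map_key surj_f_inv_f bij_is_surj)
qed

lemma sym_poly_le_mult:
  assumes P: "sym_poly_le N D P" and Q: "sym_poly_le N E Q"
  shows "sym_poly_le N (D + E) (P * Q)"
  unfolding sym_poly_le_def
proof (intro conjI allI impI)
  fix m assume "Poly_Mapping.lookup (P * Q) m \<noteq> 0"
  then have "m \<in> Poly_Mapping.keys (P * Q)" by (simp add: in_keys_iff)
  then obtain a b where m: "m = a + b" "a \<in> Poly_Mapping.keys P" "b \<in> Poly_Mapping.keys Q"
    using keys_mult[of P Q] by blast
  then have "Poly_Mapping.keys a \<subseteq> {..<N}" "Poly_Mapping.keys b \<subseteq> {..<N}"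
    "int (mdeg a) \<le> D" "int (mdeg b) \<le> E"
    using P Q by (auto simp: sym_poly_le_def in_keys_iff)
  then show "Poly_Mapping.keys m \<subseteq> {..<N}" "int (mdeg m) \<le> D + E"
    by (simp_all add: m(1) keys_add_nat mdeg_add)
next
  fix p m assume p: "p permutes {..<N}"
  then have "bij p" by (rule permutes_bij)
  then have "inj p" "inj (inv_into UNIV p)" by (auto simp: bij_is_inj bij_imp_bij_inv)
  \<comment> \<open>Renaming both parts is a bijection between the decompositions of
    \<open>m\<close> and those of its image.\<close>
  let ?f = "\<lambda>(a, b). (Poly_Mapping.map_key p a, Poly_Mapping.map_key p b)"
  let ?g = "\<lambda>(a, b). (Poly_Mapping.map_key (inv_into UNIV p) a, Poly_Mapping.map_key (inv_into UNIV p) b)"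
  have "(\<Sum>(a, b)\<in>splits m. Poly_Mapping.lookup P a * Poly_Mapping.lookup Q b) =
    (\<Sum>(a, b)\<in>splits (Poly_Mapping.map_key p m). Poly_Mapping.lookup P a * Poly_Mapping.lookup Q b)"
  proof (rule sum.reindex_bij_witness[of _ ?g ?f])
    fix ab assume "ab \<in> splits m"
    then show "?g (?f ab) = ab" "?f ab \<in> splits (Poly_Mapping.map_key p m)"
      "(case ?f ab of (a, b) \<Rightarrow> Poly_Mapping.lookup P a * Poly_Mapping.lookup Q b) =
       (case ab of (a, b) \<Rightarrow> Poly_Mapping.lookup P a * Poly_Mapping.lookup Q b)"
      using P Q p \<open>inj p\<close> \<open>bij p\<close>
      by (auto simp: splits_def map_key_inv' map_key_plus sym_poly_le_def)
  next
    fix ab assume "ab \<in> splits (Poly_Mapping.map_key p m)"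
    then show "?f (?g ab) = ab" "?g ab \<in> splits m"
      using \<open>inj (inv_into UNIV p)\<close> \<open>bij p\<close>
      by (auto simp: splits_def map_key_inv map_key_plus[symmetric] map_key_inv')
  qed
  then show "Poly_Mapping.lookup (P * Q) (Poly_Mapping.map_key p m) = Poly_Mapping.lookup (P * Q) m"
    by (simp add: lookup_mult_splits)
qed

lemma pconst_1 [simp]: "pconst 1 = 1"
  by (simp add: pconst_def)

lemma pconst_0 [simp]: "pconst 0 = 0"
  by (simp add: pconst_def)

lemma pconst_mult: "pconst (a * b) = pconst a * pconst b"
  by (simp add: pconst_def mult_single)

lemma pconst_diff: "pconst (a - b) = pconst a - pconst b"
  by (simp add: pconst_def single_diff)

lemma sym_poly_le_prod:
  "(\<And>i. i \<in> S \<Longrightarrow> sym_poly_le N (D i) (f i)) \<Longrightarrow> sym_poly_le N (sum D S) (prod f S)"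
proof (induction S rule: infinite_finite_induct)
  case (insert x F)
  then show ?case by (auto intro!: sym_poly_le_mult)
qed (use sym_poly_le_pconst[of 0 N 1] in auto)

text \<open>Row and column contributions to the bound are separate: a permutation only reorders the
  column part, so all Leibniz terms share one bound.\<close>

lemma sym_poly_le_det:
  assumes "\<And>i k. i < L \<Longrightarrow> k < L \<Longrightarrow> sym_poly_le N (D i + int k) (f i k)"
  shows "sym_poly_le N ((\<Sum>i<L. D i) + (\<Sum>k<L. int k)) (det (mat L L (\<lambda>(i, k). f i k)))"
  unfolding det_leibniz
proof (rule sym_poly_le_sum)
  fix p assume "p \<in> {p. p permutes {..<L}}"
  then have p: "p permutes {..<L}" by simp
  have "sym_poly_le N (\<Sum>i<L. D i + int (p i)) (\<Prod>i<L. f i (p i))"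
    using p permutes_in_image[OF p] by (intro sym_poly_le_prod assms) auto
  also have "(\<Sum>i<L. D i + int (p i)) = (\<Sum>i<L. D i) + (\<Sum>k<L. int k)"
    using sum.permute[OF p, of int] by (simp add: sum.distrib o_def)
  finally show "sym_poly_le N ((\<Sum>i<L. D i) + (\<Sum>k<L. int k)) (of_int (sign p) * (\<Prod>i<L. f i (p i)))"
    by (cases p rule: sign_cases) (auto intro: sym_poly_le_uminus)
qed

section \<open>Coefficientwise convergence of sequences of polynomials\<close>

definition coeffwise_convergent :: "(nat \<Rightarrow> cpoly) \<Rightarrow> bool" where
  "coeffwise_convergent G \<longleftrightarrow> (\<forall>m. convergent (\<lambda>N. Poly_Mapping.lookup (G N) m))"

lemma coeffwise_convergent_const: "coeffwise_convergent (\<lambda>N. P)"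
  by (simp add: coeffwise_convergent_def convergent_const)

lemma coeffwise_convergent_mult:
  assumes "coeffwise_convergent G" "coeffwise_convergent H"
  shows "coeffwise_convergent (\<lambda>N. G N * H N)"
  using assms unfolding coeffwise_convergent_def lookup_mult_splits case_prod_beta
  by (auto intro!: convergent_sum convergent_mult)

lemma coeffwise_convergent_sum:
  assumes "\<And>i. i \<in> S \<Longrightarrow> coeffwise_convergent (G i)"
  shows "coeffwise_convergent (\<lambda>N. \<Sum>i\<in>S. G i N)"
  using assms unfolding coeffwise_convergent_def lookup_sum by (auto intro!: convergent_sum)

lemma coeffwise_convergent_prod:
  assumes "\<And>i. i \<in> S \<Longrightarrow> coeffwise_convergent (G i)"
  shows "coeffwise_convergent (\<lambda>N. \<Prod>i\<in>S. G i N)"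
  using assms
  by (induction S rule: infinite_finite_induct)
     (auto intro: coeffwise_convergent_const coeffwise_convergent_mult)

lemma coeffwise_convergent_pconst:
  assumes "convergent c"
  shows "coeffwise_convergent (\<lambda>N. pconst (c N))"
  unfolding coeffwise_convergent_def
proof
  fix m show "convergent (\<lambda>N. Poly_Mapping.lookup (pconst (c N)) m)"
    using assms by (cases "m = 0") (simp_all add: pconst_def lookup_single when_def convergent_const)
qed

lemma coeffwise_convergent_det:
  assumes "\<And>i k. i < L \<Longrightarrow> k < L \<Longrightarrow> coeffwise_convergent (\<lambda>N. f N i k)"
  shows "coeffwise_convergent (\<lambda>N. det (mat L L (\<lambda>(i, k). f N i k)))"
  unfolding det_leibniz
  by (intro coeffwise_convergent_sum coeffwise_convergent_mult coeffwise_convergent_const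
      coeffwise_convergent_prod assms) (auto dest: permutes_in_image)

lemma coeffwise_convergent_cong:
  assumes "\<forall>\<^sub>F N in sequentially. G N = H N" "coeffwise_convergent H"
  shows "coeffwise_convergent G"
  unfolding coeffwise_convergent_def
proof
  fix m
  have ev: "\<forall>\<^sub>F N in sequentially. Poly_Mapping.lookup (G N) m = Poly_Mapping.lookup (H N) m"
    using assms(1) by (auto elim: eventually_mono)
  then show "convergent (\<lambda>N. Poly_Mapping.lookup (G N) m)"
    using assms(2) unfolding coeffwise_convergent_def convergent_cong[OF ev] by blast
qed

section \<open>Complete homogeneous symmetric polynomials\<close>

definition complete_sym :: "nat \<Rightarrow> nat \<Rightarrow> cpoly" where
  "complete_sym N n = (\<Sum>m | Poly_Mapping.keys m \<subseteq> {..<N} \<and> mdeg m = n. Poly_Mapping.single m 1)"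

lemma lookup_complete_sym:
  "Poly_Mapping.lookup (complete_sym N n) m = (if Poly_Mapping.keys m \<subseteq> {..<N} \<and> mdeg m = n then 1 else 0)"
proof -
  have fin: "finite {m. Poly_Mapping.keys m \<subseteq> {..<N} \<and> mdeg m = n}"
    by (rule finite_subset[OF _ finite_bounded_monoms[of "{..<N}" n]]) auto
  show ?thesis
    using sum.delta[OF fin, of m "\<lambda>_. 1::complex"]
    by (simp add: complete_sym_def lookup_sum lookup_single when_def)
qed

lemma sym_poly_le_complete_sym: "sym_poly_le N (int n) (complete_sym N n)"
  unfolding sym_poly_le_def lookup_complete_sym
proof (intro conjI allI impI)
  fix p and m :: monom assume p: "p permutes {..<N}"
  then have "Poly_Mapping.keys (Poly_Mapping.map_key p m) \<subseteq> {..<N} \<longleftrightarrow> Poly_Mapping.keys m \<subseteq> {..<N}"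
    unfolding keys_map_key[OF permutes_inj[OF p]] using permutes_in_image[OF p] permutes_surj[OF p]
    by (metis (no_types, lifting) subset_vimage_iff surj_image_vimage_eq permutes_image permutes_vimage vimage_mono image_mono)
  then show "(if Poly_Mapping.keys (Poly_Mapping.map_key p m) \<subseteq> {..<N} \<and> mdeg (Poly_Mapping.map_key p m) = n then 1 else 0)
    = (if Poly_Mapping.keys m \<subseteq> {..<N} \<and> mdeg m = n then 1 else (0::complex))"
    by (simp add: mdeg_map_key permutes_bij[OF p])
qed (auto split: if_splits)

text \<open>Each coefficient is constant once \<open>N\<close> exceeds all variables of its
  monomial.\<close>

lemma coeffwise_convergent_complete_sym: "coeffwise_convergent (\<lambda>N. complete_sym N n)"
  unfolding coeffwise_convergent_def
proof
  fix m :: monom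
  obtain K where K: "Poly_Mapping.keys m \<subseteq> {..<K}"
    using finite_nat_iff_bounded[of "Poly_Mapping.keys m"] by auto
  have "\<forall>\<^sub>F N in sequentially. Poly_Mapping.lookup (complete_sym N n) m = (if mdeg m = n then 1 else 0)"
    using eventually_ge_at_top[of K] by eventually_elim (use K in \<open>force simp: lookup_complete_sym\<close>)
  then show "convergent (\<lambda>N. Poly_Mapping.lookup (complete_sym N n) m)"
    by (auto intro!: convergentI tendsto_eventually)
qed

lemma lookup_pvar_mult:
  "Poly_Mapping.lookup (pvar i * P) m =
    (if i \<in> Poly_Mapping.keys m then Poly_Mapping.lookup P (m - Poly_Mapping.single i 1) else 0)"
proof -
  let ?e = "Poly_Mapping.single i 1 :: monom"
  have eq: "Poly_Mapping.lookup (pvar i * P) m =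
    (\<Sum>(a, b)\<in>splits m. if a = ?e then Poly_Mapping.lookup P b else 0)"
    unfolding lookup_mult_splits pvar_def
    by (intro sum.cong) (auto simp: lookup_single when_def)
  show ?thesis
  proof (cases "i \<in> Poly_Mapping.keys m")
    case True
    \<comment> \<open>Subtraction of exponents is truncated; \<open>i\<close> occurring in
      \<open>m\<close> ensures that adding \<open>?e\<close> back recovers \<open>m\<close>.\<close>
    define b where "b = m - ?e"
    have m: "?e + b = m"
      using True unfolding b_def
      by (intro poly_mapping_eqI) (auto simp: lookup_add lookup_minus lookup_single when_def in_keys_iff)
    have "{(?e, b)} \<subseteq> splits m" using m by (simp add: splits_def)
    moreover have "\<forall>x\<in>splits m - {(?e, b)}.
      (case x of (a, b) \<Rightarrow> if a = ?e then Poly_Mapping.lookup P b else 0) = 0"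
    proof
      fix x assume x: "x \<in> splits m - {(?e, b)}"
      have "fst x \<noteq> ?e"
      proof
        assume "fst x = ?e"
        then have "?e + snd x = ?e + b" using x m by (auto simp: splits_def)
        then have "snd x = b" by (simp only: add_left_cancel)
        with \<open>fst x = ?e\<close> x show False by (metis Diff_iff insertI1 prod.collapse)
      qed
      then show "(case x of (a, b) \<Rightarrow> if a = ?e then Poly_Mapping.lookup P b else 0) = 0"
        by (simp add: case_prod_beta)
    qed
    ultimately have "(\<Sum>(a, b)\<in>splits m. if a = ?e then Poly_Mapping.lookup P b else 0) =
      (\<Sum>(a, b)\<in>{(?e, b)}. if a = ?e then Poly_Mapping.lookup P b else 0)"
      by (rule sum.mono_neutral_right[OF finite_splits])
    then have "Poly_Mapping.lookup (pvar i * P) m = Poly_Mapping.lookup P b"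
      by (simp add: eq)
    then show ?thesis using True by (simp add: b_def)
  next
    case False
    have "\<And>b. ?e + b \<noteq> m" using False by (auto simp: keys_add_nat)
    then have "(\<Sum>(a, b)\<in>splits m. if a = ?e then Poly_Mapping.lookup P b else 0) = 0"
      by (intro sum.neutral) (auto simp: splits_def)
    then show ?thesis using False eq by simp
  qed
qed

lemma complete_sym_0_right: "complete_sym N 0 = 1"
  by (rule poly_mapping_eqI) (auto simp: lookup_complete_sym lookup_one when_def)

lemma complete_sym_0_Suc: "complete_sym 0 (Suc n) = 0"
  by (rule poly_mapping_eqI) (auto simp: lookup_complete_sym)

text \<open>A monomial either avoids the last variable or is divisible by it.\<close>

lemma complete_sym_Suc_Suc:
  "complete_sym (Suc N) (Suc n) = complete_sym N (Suc n) + pvar N * complete_sym (Suc N) n"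
proof (rule poly_mapping_eqI)
  fix m
  let ?e = "Poly_Mapping.single N 1 :: monom"
  show "Poly_Mapping.lookup (complete_sym (Suc N) (Suc n)) m =
    Poly_Mapping.lookup (complete_sym N (Suc n) + pvar N * complete_sym (Suc N) n) m"
  proof (cases "N \<in> Poly_Mapping.keys m")
    case True
    define b where "b = m - ?e"
    have m: "m = ?e + b"
      using True unfolding b_def
      by (intro poly_mapping_eqI) (auto simp: lookup_add lookup_minus lookup_single when_def in_keys_iff)
    have "mdeg m = Suc (mdeg b)" "Poly_Mapping.keys m = insert N (Poly_Mapping.keys b)"
      by (simp_all add: m mdeg_add keys_add_nat)
    moreover have "m - Poly_Mapping.single N (Suc 0) = b" by (simp add: b_def)
    ultimately show ?thesis using True
      by (auto simp: lookup_add lookup_pvar_mult lookup_complete_sym)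
  next
    case False
    then have "Poly_Mapping.keys m \<subseteq> {..<Suc N} \<longleftrightarrow> Poly_Mapping.keys m \<subseteq> {..<N}"
      by (auto simp: less_Suc_eq)
    then show ?thesis using False
      by (simp add: lookup_add lookup_pvar_mult lookup_complete_sym)
  qed
qed

text \<open>By the recursion above, multiplying the generating function by 1 - x_N t strips off the
  last variable.\<close>

lemma is_complete_complete_sym: "is_complete pvar N (complete_sym N)"
proof (induction N)
  case 0
  have "Abs_fps (complete_sym 0) = 1"
  proof (rule fps_ext)
    fix n show "fps_nth (Abs_fps (complete_sym 0)) n = fps_nth 1 n"
      by (cases n) (simp_all add: complete_sym_0_right complete_sym_0_Suc)
  qed
  then show ?case by (simp add: is_complete_def)
next
  case (Suc N)
  have "Abs_fps (complete_sym (Suc N)) * (1 - fps_const (pvar N) * fps_X) = Abs_fps (complete_sym N)"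
  proof (rule fps_ext)
    fix n
    have eq: "Abs_fps (complete_sym (Suc N)) * (1 - fps_const (pvar N) * fps_X) =
      Abs_fps (complete_sym (Suc N)) - fps_const (pvar N) * (Abs_fps (complete_sym (Suc N)) * fps_X)"
      by (simp only: right_diff_distrib mult_1_right mult.left_commute)
    show "fps_nth (Abs_fps (complete_sym (Suc N)) * (1 - fps_const (pvar N) * fps_X)) n =
      fps_nth (Abs_fps (complete_sym N)) n"
      unfolding eq by (cases n) (simp_all add: complete_sym_0_right complete_sym_Suc_Suc)
  qed
  then show ?case using Suc.IH unfolding is_complete_def
    by (simp only: prod.lessThan_Suc mult.assoc mult.commute[of "prod _ _" "_ - _"])
       (simp only: mult.assoc[symmetric])
qed

section \<open>Partition statistics\<close>

text \<open>The positions of nonzero parts form a finite downward closed set, that is, an initial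
  segment whose length is its cardinality.\<close>

lemma is_partition_nonzero_iff:
  assumes "is_partition la"
  shows "la i \<noteq> 0 \<longleftrightarrow> i < plen la"
proof -
  let ?S = "{i. la i \<noteq> 0}"
  have fin: "finite ?S" and anti: "antimono la" using assms by (auto simp: is_partition_def)
  have down: "{..i} \<subseteq> ?S" if "i \<in> ?S" for i
    using that antimonoD[OF anti] by fastforce
  show ?thesis
  proof
    assume "la i \<noteq> 0"
    then have "card {..i} \<le> card ?S" using down[of i] fin by (intro card_mono) auto
    then show "i < plen la" by (simp add: plen_def)
  next
    assume i: "i < plen la"
    show "la i \<noteq> 0"
    proof
      assume "la i = 0"
      then have "j < i" if "la j \<noteq> 0" for j
        using that antimonoD[OF anti, of i j] by (cases "i \<le> j") auto
      then have "?S \<subseteq> {..<i}" by auto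
      then have "card ?S \<le> card {..<i}" by (intro card_mono) auto
      with i show False by (simp add: plen_def)
    qed
  qed
qed

lemma plen_mono:
  assumes "is_partition la" "mu \<le> la"
  shows "plen mu \<le> plen la"
  unfolding plen_def
proof (rule card_mono)
  show "{i. mu i \<noteq> 0} \<subseteq> {i. la i \<noteq> 0}"
    using assms(2) by (auto simp: le_fun_def intro: less_le_trans)
qed (use assms in \<open>simp add: is_partition_def\<close>)

text \<open>Padding with zero parts lets two partitions be summed over one common range.\<close>

lemma sum_parts_extend:
  assumes "is_partition mu" "plen mu \<le> L"
  shows "(\<Sum>i<plen mu. f i * mu i) = (\<Sum>i<L. f i * mu i)"
proof (rule sum.mono_neutral_left)
  have "mu i = 0" if "\<not> i < plen mu" for i using is_partition_nonzero_iff[OF assms(1), of i] that by blast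
  then show "\<forall>i\<in>{..<L} - {..<plen mu}. f i * mu i = 0" by simp
qed (use assms(2) in auto)

lemma psize_eq_sum:
  assumes "is_partition mu" "plen mu \<le> L"
  shows "psize mu = (\<Sum>i<L. mu i)"
  using sum_parts_extend[OF assms, of "\<lambda>_. 1"] by (simp add: psize_def)

lemma pn_eq_sum:
  assumes "is_partition mu" "plen mu \<le> L"
  shows "pn mu = (\<Sum>i<L. i * mu i)"
  using sum_parts_extend[OF assms, of "\<lambda>i. i"] by (simp add: pn_def)

lemma finite_parts_gt:
  assumes "is_partition mu" shows "finite {i. j < mu i}"
  using assms by (auto simp: is_partition_def elim: finite_subset[rotated])

lemma is_partition_transposed:
  assumes "is_partition mu"
  shows "is_partition (transposed mu)"
proof -
  have "antimono (transposed mu)"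
    unfolding transposed_def
    by (intro antimonoI card_mono finite_parts_gt[OF assms]) auto
  have zero: "transposed mu j = 0" if "mu 0 \<le> j" for j
  proof -
    have "mu i \<le> mu 0" for i using assms by (auto simp: is_partition_def antimono_def)
    then have "{i. j < mu i} = {}" using that by (metis (no_types, lifting) Collect_empty_eq leD le_trans)
    then show ?thesis by (simp add: transposed_def)
  qed
  have "{j. transposed mu j \<noteq> 0} \<subseteq> {..<mu 0}"
  proof
    fix j assume "j \<in> {j. transposed mu j \<noteq> 0}"
    then have "transposed mu j \<noteq> 0" by simp
    then show "j \<in> {..<mu 0}" using zero[of j] by (cases "mu 0 \<le> j") simp_all
  qed
  then have "finite {j. transposed mu j \<noteq> 0}" by (rule finite_subset) simp
  with \<open>antimono (transposed mu)\<close> show ?thesis by (simp add: is_partition_def)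
qed

text \<open>Double counting of the cells of the diagram, each weighted by its column index.\<close>

lemma pn_transposed:
  assumes "is_partition mu" "plen mu \<le> L"
  shows "pn (transposed mu) = (\<Sum>i<L. \<Sum>j<mu i. j)"
proof -
  \<comment> \<open>A common bound for the length of the transpose and for all parts.\<close>
  define B where "B = max (plen (transposed mu)) (mu 0)"
  have "mu i \<le> mu 0" for i using assms(1) by (auto simp: is_partition_def antimono_def)
  then have le: "mu i \<le> B" for i unfolding B_def using max.coboundedI2 by blast
  have card: "transposed mu j = (\<Sum>i<L. if j < mu i then 1 else 0)" for j
  proof -
    have "i < L" if "j < mu i" for i
      using that assms(2) is_partition_nonzero_iff[OF assms(1), of i] by simp
    then have "{i. j < mu i} = {i\<in>{..<L}. j < mu i}" by blast
    then show ?thesis unfolding transposed_def by (simp add: sum.If_cases Int_def)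
  qed
  have "pn (transposed mu) = (\<Sum>j<B. j * transposed mu j)"
    by (rule pn_eq_sum) (auto simp: is_partition_transposed assms B_def)
  also have "\<dots> = (\<Sum>i<L. \<Sum>j<B. if j < mu i then j else 0)"
    unfolding card sum_distrib_left by (subst sum.swap) (auto intro!: sum.cong)
  also have "\<dots> = (\<Sum>i<L. \<Sum>j<mu i. j)"
  proof (rule sum.cong[OF refl])
    fix i
    show "(\<Sum>j<B. if j < mu i then j else 0) = (\<Sum>j<mu i. j)"
      using le[of i] by (intro sum.mono_neutral_cong_right) auto
  qed
  finally show ?thesis .
qed

lemma two_pn_transposed:
  assumes "is_partition mu" "plen mu \<le> L"
  shows "2 * int (pn (transposed mu)) = (\<Sum>i<L. int (mu i) * (int (mu i) - 1))"
proof -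
  have "2 * (\<Sum>j<n. int j) = int n * (int n - 1)" for n
    by (induction n) (auto simp: algebra_simps)
  then show ?thesis by (simp add: pn_transposed[OF assms] sum_distrib_left)
qed

text \<open>With A = nu_j - j one has A(A + 1) = nu_j(nu_j - 1) + 2 nu_j - 2 j nu_j + j(j - 1), and
  the last term cancels in the difference. Doubling avoids integer division.\<close>

lemma two_n_exponent:
  assumes "is_partition la" "is_partition mu" "plen la \<le> L" "plen mu \<le> L"
  shows "2 * (int (psize la) - int (psize mu) - n_exponent la mu) =
    (\<Sum>j<L. (int (la j) - int j) * (int (la j) - int j + 1)) -
    (\<Sum>j<L. (int (mu j) - int j) * (int (mu j) - int j + 1))"
proof -
  have "(\<Sum>j<L. (int (nu j) - int j) * (int (nu j) - int j + 1)) =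
    2 * int (pn (transposed nu)) - 2 * int (pn nu) + 2 * int (psize nu) + (\<Sum>j<L. int j * (int j - 1))"
    if "is_partition nu" "plen nu \<le> L" for nu
    unfolding two_pn_transposed[OF that] pn_eq_sum[OF that] psize_eq_sum[OF that]
    by (simp add: sum_distrib_left algebra_simps flip: sum.distrib sum_subtractf)
  from this[of la] this[of mu] show ?thesis using assms by (simp add: n_exponent_def)
qed

section \<open>Existence of the interpolation functions\<close>

text \<open>The generating function exhibits the symmetry in the arguments that the recursion hides;
  it allows the shifts to be read in reverse order.\<close>

lemma elem_coeff_eq_fps_nth:
  "elem_coeff c M r = fps_nth (\<Prod>l<M. 1 - fps_const (c l) * fps_X) r"
proof (induction c M r rule: elem_coeff.induct)
  case (2 c M)
  have "fps_nth (\<Prod>l<M'. 1 - fps_const (c l) * fps_X) 0 = 1" for M'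
    by (induction M') auto
  then show ?case by (simp only: elem_coeff.simps)
next
  case (3 c M r)
  have "(\<Prod>l<Suc M. 1 - fps_const (c l) * fps_X) = (\<Prod>l<M. 1 - fps_const (c l) * fps_X)
      - fps_const (c M) * ((\<Prod>l<M. 1 - fps_const (c l) * fps_X) * fps_X)"
    by (simp only: prod.lessThan_Suc right_diff_distrib mult_1_right mult.left_commute)
  then show ?case using 3 by (simp del: prod.lessThan_Suc)
qed simp

lemma elem_coeff_rev: "elem_coeff (\<lambda>l. c (M - 1 - l)) M r = elem_coeff c M r"
  unfolding elem_coeff_eq_fps_nth
  by (rule arg_cong[where f = "\<lambda>P. fps_nth P r"],
      rule prod.reindex_bij_witness[of _ "\<lambda>l. M - 1 - l" "\<lambda>l. M - 1 - l"]) auto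

lemma elem_coeff_pconst: "elem_coeff (\<lambda>l. pconst (c l)) M r = pconst (elem_coeff c M r)"
  by (induction c M r rule: elem_coeff.induct) (simp_all add: pconst_mult pconst_diff)

lemma elem_coeff_cong: "(\<And>l. l < M \<Longrightarrow> c l = c' l) \<Longrightarrow> elem_coeff c M r = elem_coeff c' M r"
  unfolding elem_coeff_eq_fps_nth by (intro arg_cong[where f = "\<lambda>P. fps_nth P r"] prod.cong) auto

text \<open>Unrolling the recursion in \<open>M\<close> writes the coefficient for
  \<open>Suc r\<close> as a partial sum of a series. By induction the coefficients for
  \<open>r\<close> are bounded, so a geometric series dominates it.\<close>

lemma convergent_elem_coeff_geometric:
  fixes b q :: complex
  assumes "norm q < 1"
  shows "convergent (\<lambda>M. elem_coeff (\<lambda>l. b * q ^ l) M r)"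
proof (induction r)
  case 0
  then show ?case by (simp add: convergent_const)
next
  case (Suc r)
  let ?e = "\<lambda>M. elem_coeff (\<lambda>l. b * q ^ l) M"
  have "Bseq (\<lambda>M. ?e M r)" using Suc by (rule convergent_imp_Bseq)
  then obtain K where K: "\<And>M. norm (?e M r) \<le> K" by (auto simp: Bseq_def)
  have "summable (\<lambda>M. norm b * K * norm q ^ M)"
    using assms by (intro summable_mult summable_geometric) simp
  then have "summable (\<lambda>M. b * q ^ M * ?e M r)"
  proof (rule summable_comparison_test'[where N = 0])
    fix M
    show "norm (b * q ^ M * ?e M r) \<le> norm b * K * norm q ^ M"
      using mult_left_mono[OF K[of M], of "norm b * norm q ^ M"]
      by (simp add: norm_mult norm_power mult_ac)
  qed
  moreover have "?e M (Suc r) = - (\<Sum>k<M. b * q ^ k * ?e k r)" for M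
    by (induction M) auto
  ultimately show ?case
    by (simp add: convergent_minus_iff[symmetric] summable_iff_convergent)
qed

lemma pvar_eq_iff: "pvar i = pvar j \<longleftrightarrow> i = j"
proof
  assume "pvar i = pvar j"
  then have "Poly_Mapping.keys (pvar i) = Poly_Mapping.keys (pvar j)" by simp
  then have "Poly_Mapping.single i (1::nat) = Poly_Mapping.single j 1" by (simp add: pvar_def)
  then have "Poly_Mapping.keys (Poly_Mapping.single i (1::nat)) = Poly_Mapping.keys (Poly_Mapping.single j (1::nat))"
    by simp
  then show "i = j" by simp
qed simp

text \<open>Factor the alternant, identify the cofactor determinant with the Vandermonde product and
  drop the rows of zero parts. Cancelling the nonzero Vandermonde product gives the uniqueness that
  \<open>THE\<close> requires.\<close>

lemma interp_schur_eq_det: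
  assumes mu: "is_partition mu" and L: "plen mu \<le> N"
  shows "interp_schur N c mu = det (mat (plen mu) (plen mu) (\<lambda>(i, k).
    row_entry (complete_sym N) (\<lambda>l. pconst (c l)) (mu i + N - Suc i) (N - 1 - k)))"
proof -
  let ?S = "det (mat (plen mu) (plen mu) (\<lambda>(i, k).
    row_entry (complete_sym N) (\<lambda>l. pconst (c l)) (mu i + N - Suc i) (N - 1 - k)))"
  let ?A = "det (mat N N (\<lambda>(i, j). shifted_power (pvar j) c (mu i + N - Suc i)))"
  have c: "is_complete pvar N (complete_sym N)" by (rule is_complete_complete_sym)
  have V: "det (cofactor_mat pvar N) = vandermonde N"
    unfolding vandermonde_def by (rule det_cofactor_mat[OF c])
  have mu0: "mu i = 0" if "plen mu \<le> i" for i
    using is_partition_nonzero_iff[OF mu, of i] that by simp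
  have "?A = det (mat N N (\<lambda>(i, k).
    row_entry (complete_sym N) (\<lambda>l. pconst (c l)) (mu i + N - Suc i) (N - 1 - k))) * vandermonde N"
    unfolding shifted_power_def V[symmetric] by (rule det_shifted_powers[OF c])
  also have "det (mat N N (\<lambda>(i, k).
    row_entry (complete_sym N) (\<lambda>l. pconst (c l)) (mu i + N - Suc i) (N - 1 - k))) = ?S"
    by (rule det_row_entry_reduce) (use L in \<open>auto simp: complete_sym_0_right mu0\<close>)
  finally have eq: "?S * vandermonde N = ?A" ..
  have V0: "vandermonde N \<noteq> 0"
    unfolding vandermonde_def by (auto simp: pvar_eq_iff)
  then have "P = ?S" if "P * vandermonde N = ?A" for P
  proof -
    have "P * vandermonde N = ?S * vandermonde N" by (rule trans[OF that eq[symmetric]])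
    then show ?thesis unfolding mult_right_cancel[OF V0] .
  qed
  with eq show ?thesis unfolding interp_schur_def by (rule the_equality)
qed

text \<open>
  Read backwards, the shifts \<open>q\<^sup>N\<^sup>-\<^sup>1, q\<^sup>N\<^sup>-\<^sup>2, \<dots>\<close> of row \<open>i\<close> form a geometric progression whose first term
  does not depend on \<open>N\<close>.
\<close>

definition interp_JT_entry :: "complex \<Rightarrow> (nat \<Rightarrow> nat) \<Rightarrow> nat \<Rightarrow> nat \<Rightarrow> nat \<Rightarrow> cpoly" where
  "interp_JT_entry q mu N i k = (if i \<le> mu i + k then
     (\<Sum>r\<le>mu i + k - i. pconst (elem_coeff (\<lambda>l. q powi (int i + 1 - int (mu i)) * q ^ l) (mu i + N - Suc i) r)
        * complete_sym N (mu i + k - i - r)) else 0)"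

lemma row_entry_eq_JT_entry:
  assumes q: "q \<noteq> 0" and "i < N" "k < N"
  shows "row_entry (complete_sym N) (\<lambda>l. pconst (q powi (int N - 1 - int l))) (mu i + N - Suc i) (N - 1 - k)
    = interp_JT_entry q mu N i k"
proof -
  let ?M = "mu i + N - Suc i" and ?c = "\<lambda>l. q powi (int N - 1 - int l)"
  have e: "elem_coeff ?c ?M r = elem_coeff (\<lambda>l. q powi (int i + 1 - int (mu i)) * q ^ l) ?M r" for r
  \<comment> \<open>After the reversal \<open>N\<close> cancels from the exponent of the shift with
    index \<open>l\<close>.\<close>
  proof (subst elem_coeff_rev[symmetric], rule elem_coeff_cong)
    fix l assume l: "l < ?M"
    then have "int (?M - 1 - l) = int (mu i) + int N - int i - 2 - int l" by linarith
    then have ex: "int N - 1 - int (?M - 1 - l) = (int i + 1 - int (mu i)) + int l" by linarith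
    show "q powi (int N - 1 - int (?M - 1 - l)) = q powi (int i + 1 - int (mu i)) * q ^ l"
      unfolding ex using q by (subst power_int_add) simp_all
  qed
  show ?thesis
  proof (cases "i \<le> mu i + k")
    case False
    then have "?M < N - 1 - k" using assms by linarith
    then show ?thesis using False by (simp add: row_entry_below interp_JT_entry_def)
  next
    case True
    \<comment> \<open>The summation bound \<open>?M - (N - 1 - k)\<close> equals
      \<open>mu i + k - i\<close>, which is free of \<open>N\<close>.\<close>
    let ?n = "mu i + k - i"
    have n: "?n \<le> ?M" "?M = ?n + (N - 1 - k)" using True assms by auto
    have "row_entry (complete_sym N) (\<lambda>l. pconst (?c l)) ?M (N - 1 - k) =
      (\<Sum>r\<le>?n. elem_coeff (\<lambda>l. pconst (?c l)) ?M r * complete_sym N (?n - r))"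
      unfolding row_entry_def by (rule sum.mono_neutral_cong_right) (use n in auto)
    then show ?thesis using True by (simp add: interp_JT_entry_def elem_coeff_pconst e)
  qed
qed

lemma sym_poly_le_JT_entry: "sym_poly_le N ((int (mu i) - int i) + int k) (interp_JT_entry q mu N i k)"
proof (cases "i \<le> mu i + k")
  case True
  then have "sym_poly_le N (int (mu i + k - i)) (interp_JT_entry q mu N i k)"
    unfolding interp_JT_entry_def
    by (auto intro!: sym_poly_le_sum sym_poly_le_mono[OF sym_poly_le_mult[OF sym_poly_le_pconst[of 0] sym_poly_le_complete_sym]])
  also have "int (mu i + k - i) = (int (mu i) - int i) + int k" using True by linarith
  finally show ?thesis .
qed (simp add: interp_JT_entry_def)

text \<open>The summation range is fixed; only the length of the geometric progression and the
  number of variables grow with \<open>N\<close>.\<close>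

lemma coeffwise_convergent_JT_entry:
  assumes "norm q < 1"
  shows "coeffwise_convergent (\<lambda>N. interp_JT_entry q mu N i k)"
proof (cases "i \<le> mu i + k")
  case True
  have "filterlim (\<lambda>N. mu i + N - Suc i) at_top at_top"
  proof (subst filterlim_at_top, intro allI)
    fix Z show "\<forall>\<^sub>F N in at_top. Z \<le> mu i + N - Suc i"
      using eventually_ge_at_top[of "Z + Suc i"] by eventually_elim simp
  qed
  then have "convergent (\<lambda>N. elem_coeff (\<lambda>l. b * q ^ l) (mu i + N - Suc i) r)" for b r
    using convergent_elem_coeff_geometric[OF assms, of b r] filterlim_compose
    unfolding convergent_def by fast
  then show ?thesis using True unfolding interp_JT_entry_def
    by (auto intro!: coeffwise_convergent_sum coeffwise_convergent_mult coeffwise_convergent_pconst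
        coeffwise_convergent_complete_sym)
qed (simp add: interp_JT_entry_def coeffwise_convergent_const)

text \<open>From \<open>N = plen mu\<close> on, the interpolation polynomial is a determinant of
  fixed size with convergent entries; the limit therefore exists and inherits the degree
  bound.\<close>

lemma I_A_in_Sym_upto:
  assumes mu: "is_partition mu" and q: "q \<noteq> 0" "norm q < 1"
  shows "I_A q mu \<in> Sym_upto (psize mu)"
proof -
  let ?G = "\<lambda>N. interp_schur N (\<lambda>k. q powi (int N - 1 - int k)) mu"
  let ?L = "plen mu"
  let ?H = "\<lambda>N. det (mat ?L ?L (\<lambda>(i, k). interp_JT_entry q mu N i k))"
  have eq: "\<forall>\<^sub>F N in sequentially. ?G N = ?H N"
    using eventually_ge_at_top[of ?L]
  proof eventually_elim
    case (elim N)
    show ?case unfolding interp_schur_eq_det[OF mu elim]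
      by (intro arg_cong[where f = det] cong_mat) (use elim q in \<open>auto simp: row_entry_eq_JT_entry[simplified]\<close>)
  qed
  have "?H N \<in> SymPoly_upto N (psize mu)" for N
  proof -
    have "sym_poly_le N ((\<Sum>i<?L. int (mu i) - int i) + (\<Sum>k<?L. int k)) (?H N)"
      by (rule sym_poly_le_det) (rule sym_poly_le_JT_entry)
    \<comment> \<open>The staircase contributions of rows and columns cancel.\<close>
    also have "(\<Sum>i<?L. int (mu i) - int i) + (\<Sum>k<?L. int k) = int (psize mu)"
      by (simp add: psize_def sum_subtractf)
    finally show ?thesis by (simp add: sym_poly_le_nat)
  qed
  then have mem: "\<forall>\<^sub>F N in sequentially. ?G N \<in> SymPoly_upto N (psize mu)"
    using eq by (auto elim!: eventually_mono)
  have "coeffwise_convergent ?G"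
    using eq by (rule coeffwise_convergent_cong)
      (intro coeffwise_convergent_det coeffwise_convergent_JT_entry q)
  then have conv: "convergent (\<lambda>N. Poly_Mapping.lookup (?G N) m)" for m
    by (simp add: coeffwise_convergent_def)
  note F = sym_converges_lim[OF mem conv]
  have "I_A q mu = (\<lambda>m. lim (\<lambda>N. Poly_Mapping.lookup (?G N) m))"
    unfolding I_A_def
    by (rule the_equality[where P = "sym_converges ?G", OF F(2)], rule sym_converges_unique[OF _ F(2)])
  with F(1) show ?thesis by simp
qed

section \<open>The limit of the coefficients\<close>

lemma sum_index_gap_permutes:
  assumes "p permutes {..<L}"
  shows "(\<Sum>j<L. index_gap la mu j (p j)) = (\<Sum>j<L. int (la j)) - (\<Sum>j<L. int (mu j))"
  using sum.permute[OF assms, of int] sum.permute[OF assms, of "\<lambda>j. int (mu j)"]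
  by (simp add: index_gap_def sum.distrib sum_subtractf o_def)

text \<open>For \<open>a\<close> \<noteq> 0, absorbing one \<open>a\<close> into each factor turns
  it into \<open>a - c * y * q ^ k\<close>, which is continuous at \<open>0\<close>.\<close>

lemma power_mult_qpoch_tendsto:
  fixes c q y :: complex
  shows "((\<lambda>a::real. of_real a ^ n * qpoch (c / of_real a * y) q n) \<longlongrightarrow> (\<Prod>k<n. - (c * y * q ^ k)))
    (at 0 within S)"
proof -
  have "((\<lambda>a::real. \<Prod>k<n. of_real a - c * y * q ^ k) \<longlongrightarrow> (\<Prod>k<n. of_real 0 - c * y * q ^ k))
    (at 0 within S)"
    by (intro tendsto_intros)
  moreover have "\<forall>\<^sub>F a::real in at 0 within S. (\<Prod>k<n. of_real a - c * y * q ^ k) =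
    of_real a ^ n * qpoch (c / of_real a * y) q n"
    unfolding eventually_at_filter
  proof (intro always_eventually allI impI)
    fix a :: real assume "a \<noteq> 0"
    then have "of_real a - c * y * q ^ k = of_real a * (1 - c / of_real a * y * q ^ k)" for k
      by (simp add: field_simps)
    then show "(\<Prod>k<n. of_real a - c * y * q ^ k) = of_real a ^ n * qpoch (c / of_real a * y) q n"
      by (simp add: qpoch_def prod.distrib)
  qed
  ultimately show ?thesis by (simp add: tendsto_cong)
qed

text \<open>
  With \<open>A = \<lambda>\<^sub>j - j\<close> and \<open>B = \<mu>\<^sub>k - k\<close> the exponent is a difference of a function of \<open>A\<close> and one of \<open>B\<close>;
  hence its sum over \<open>j\<close> is the same for all permutations.
\<close>

lemma prod_geometric_powi:
  fixes c q :: complex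
  assumes "q \<noteq> 0" "int n = A - B"
  obtains e where "2 * e = A * (A + 1) - B * (B + 1)"
    "(\<Prod>k<n. - (c * q powi (B + 1) * q ^ k)) = (- c) ^ n * q powi e"
proof
  define e where "e = (\<Sum>k<n. B + 1 + int k)"
  have "2 * (\<Sum>k<m. B + 1 + int k) = (B + int m) * (B + int m + 1) - B * (B + 1)" for m
    by (induction m) (auto simp: algebra_simps)
  from this[of n] show "2 * e = A * (A + 1) - B * (B + 1)" using assms(2) by (simp add: e_def)
  have "(\<Prod>k<m. - (c * q powi (B + 1) * q ^ k)) = (- c) ^ m * q powi (\<Sum>k<m. B + 1 + int k)" for m
    by (induction m) (simp_all add: power_int_add assms(1))
  then show "(\<Prod>k<n. - (c * q powi (B + 1) * q ^ k)) = (- c) ^ n * q powi e" by (simp add: e_def)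
qed

lemma prod_powi_sum:
  fixes q :: complex
  assumes "q \<noteq> 0" shows "(\<Prod>j\<in>S. q powi (e j)) = q powi (\<Sum>j\<in>S. e j)"
  by (induction S rule: infinite_finite_induct) (simp_all add: power_int_add assms)

definition qM_entry :: "(nat \<Rightarrow> nat) \<Rightarrow> (nat \<Rightarrow> nat) \<Rightarrow> complex \<Rightarrow> complex \<Rightarrow> nat \<Rightarrow> nat \<Rightarrow> complex" where
  "qM_entry la mu q x j k = (let n = index_gap la mu j k in
     if n < 0 then 0
     else qpoch (x * q powi (int (mu k) + 1 - int k)) q (nat n) / qpoch q q (nat n))"

definition ASC_entry :: "(nat \<Rightarrow> nat) \<Rightarrow> (nat \<Rightarrow> nat) \<Rightarrow> complex \<Rightarrow> nat \<Rightarrow> nat \<Rightarrow> complex" where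
  "ASC_entry la mu q j k = (let n = index_gap la mu j k in
     if n < 0 then 0 else 1 / qpoch q q (nat n))"

text \<open>The gaps add up to \<open>D\<close>, so \<open>a ^ D\<close> distributes over the rows.
  The resulting power of \<open>q\<close> is the same for every permutation and can later be pulled
  out of the Leibniz sum.\<close>

lemma prod_qM_entry_tendsto:
  fixes q c :: complex
  assumes q: "q \<noteq> 0" and la: "is_partition la" and mu: "is_partition mu" and le: "mu \<le> la"
    and p: "p permutes {..<plen la}"
  defines "D \<equiv> psize la - psize mu"
  shows "((\<lambda>a::real. of_real a ^ D * (\<Prod>j<plen la. qM_entry la mu q (c / of_real a) j (p j))) \<longlongrightarrow>
    (- c) ^ D * q powi (int D - n_exponent la mu) * (\<Prod>j<plen la. ASC_entry la mu q j (p j)))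
    (at 0 within S)"
\<comment> \<open>A negative gap makes both products vanish; otherwise all gaps are natural
  numbers.\<close>
proof (cases "\<exists>j<plen la. index_gap la mu j (p j) < 0")
  case True
  then obtain j where "j < plen la" "index_gap la mu j (p j) < 0" by blast
  then have z: "(\<Prod>j<plen la. qM_entry la mu q x j (p j)) = 0"
            "(\<Prod>j<plen la. ASC_entry la mu q j (p j)) = 0" for x
    by (auto intro!: prod_zero bexI[of _ j] simp: qM_entry_def ASC_entry_def)
  show ?thesis unfolding z by simp
next
  case False
  let ?L = "plen la"
  define n where "n = (\<lambda>j. nat (index_gap la mu j (p j)))"
  have n: "int (n j) = (int (la j) - int j) - (int (mu (p j)) - int (p j))" if "j < ?L" for j
    using False that by (auto simp: n_def index_gap_def)
  have mL: "plen mu \<le> ?L" using plen_mono[OF la le] .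
  have psle: "psize mu \<le> psize la"
    using le by (auto simp: psize_eq_sum[OF mu mL] psize_eq_sum[OF la order_refl] le_fun_def intro: sum_mono)
  have iD: "int D = int (psize la) - int (psize mu)" using psle by (simp add: D_def)
  have "(\<Sum>j<?L. int (n j)) = (\<Sum>j<?L. index_gap la mu j (p j))"
    using False by (intro sum.cong) (auto simp: n_def)
  also have "\<dots> = int D"
    unfolding sum_index_gap_permutes[OF p] iD
    by (simp add: psize_eq_sum[OF mu mL] psize_eq_sum[OF la order_refl])
  finally have sumn: "(\<Sum>j<?L. n j) = D" by (metis of_nat_eq_iff of_nat_sum)
  have "\<exists>e. \<forall>j<?L. 2 * e j = (int (la j) - int j) * (int (la j) - int j + 1)
        - (int (mu (p j)) - int (p j)) * (int (mu (p j)) - int (p j) + 1) \<and>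
     (\<Prod>k<n j. - (c * q powi (int (mu (p j)) - int (p j) + 1) * q ^ k)) = (- c) ^ n j * q powi e j"
    by (rule choice) (use prod_geometric_powi[OF q n] in metis)
  then obtain e where e: "\<And>j. j < ?L \<Longrightarrow> 2 * e j = (int (la j) - int j) * (int (la j) - int j + 1)
        - (int (mu (p j)) - int (p j)) * (int (mu (p j)) - int (p j) + 1)"
     "\<And>j. j < ?L \<Longrightarrow> (\<Prod>k<n j. - (c * q powi (int (mu (p j)) - int (p j) + 1) * q ^ k)) = (- c) ^ n j * q powi e j"
    by blast
  have "2 * (\<Sum>j<?L. e j) = (\<Sum>j<?L. (int (la j) - int j) * (int (la j) - int j + 1)) -
      (\<Sum>j<?L. (int (mu (p j)) - int (p j)) * (int (mu (p j)) - int (p j) + 1))"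
    by (simp add: sum_distrib_left e(1) sum_subtractf)
  \<comment> \<open>The permutation merely reorders the part that depends on
    \<open>mu (p j) - p j\<close>.\<close>
  also have "\<dots> = (\<Sum>j<?L. (int (la j) - int j) * (int (la j) - int j + 1)) -
      (\<Sum>j<?L. (int (mu j) - int j) * (int (mu j) - int j + 1))"
    using sum.permute[OF p, of "\<lambda>j. (int (mu j) - int j) * (int (mu j) - int j + 1)"] by (simp add: o_def)
  also have "\<dots> = 2 * (int D - n_exponent la mu)"
    using two_n_exponent[OF la mu order_refl mL] by (simp add: iD)
  finally have sume: "(\<Sum>j<?L. e j) = int D - n_exponent la mu" by simp
  have "((\<lambda>a::real. \<Prod>j<?L. of_real a ^ n j * qpoch (c / of_real a * q powi (int (mu (p j)) - int (p j) + 1)) q (n j)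
        * inverse (qpoch q q (n j))) \<longlongrightarrow>
     (\<Prod>j<?L. (\<Prod>k<n j. - (c * q powi (int (mu (p j)) - int (p j) + 1) * q ^ k)) * inverse (qpoch q q (n j))))
     (at 0 within S)"
    by (intro tendsto_prod tendsto_mult_right power_mult_qpoch_tendsto)
  also have "(\<Prod>j<?L. (\<Prod>k<n j. - (c * q powi (int (mu (p j)) - int (p j) + 1) * q ^ k)) * inverse (qpoch q q (n j)))
    = (\<Prod>j<?L. (- c) ^ n j * q powi e j * ASC_entry la mu q j (p j))"
  proof (rule prod.cong[OF refl])
    fix j assume "j \<in> {..<?L}"
    then have j: "j < ?L" by simp
    then have "ASC_entry la mu q j (p j) = inverse (qpoch q q (n j))"
      using False by (simp add: ASC_entry_def n_def divide_inverse)
    then show "(\<Prod>k<n j. - (c * q powi (int (mu (p j)) - int (p j) + 1) * q ^ k)) * inverse (qpoch q q (n j))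
      = (- c) ^ n j * q powi e j * ASC_entry la mu q j (p j)"
      by (simp only: e(2)[OF j])
  qed
  also have "\<dots> = (- c) ^ D * q powi (int D - n_exponent la mu) * (\<Prod>j<?L. ASC_entry la mu q j (p j))"
    by (simp only: prod.distrib prod_powi_sum[OF q] sume power_sum[symmetric] sumn)
  also have "(\<lambda>a::real. \<Prod>j<?L. of_real a ^ n j * qpoch (c / of_real a * q powi (int (mu (p j)) - int (p j) + 1)) q (n j)
        * inverse (qpoch q q (n j))) =
     (\<lambda>a. \<Prod>j<?L. of_real a ^ n j * qM_entry la mu q (c / of_real a) j (p j))"
  proof (rule ext, rule prod.cong[OF refl])
    fix a :: real and j assume "j \<in> {..<?L}"
    then have gap: "\<not> index_gap la mu j (p j) < 0" using False by simp
    have ex: "int (mu (p j)) - int (p j) + 1 = int (mu (p j)) + 1 - int (p j)" by simp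
    show "of_real a ^ n j * qpoch (c / of_real a * q powi (int (mu (p j)) - int (p j) + 1)) q (n j)
        * inverse (qpoch q q (n j)) = of_real a ^ n j * qM_entry la mu q (c / of_real a) j (p j)"
      unfolding ex using gap by (simp add: qM_entry_def n_def divide_inverse Let_def)
  qed
  also have "\<dots> = (\<lambda>a. of_real a ^ D * (\<Prod>j<?L. qM_entry la mu q (c / of_real a) j (p j)))"
    by (simp only: prod.distrib power_sum[symmetric] sumn)
  finally show ?thesis .
qed

text \<open>Every Leibniz term takes up the full power \<open>a ^ D\<close>. In the limit,
  \<open>q ^ D\<close> cancels the \<open>q\<close> in \<open>1 / (q * d)\<close>, and
  \<open>q powi (- ?E)\<close> reduces the exponent \<open>2 * ?E\<close> to
  \<open>?E\<close>.\<close>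

lemma sigma_qM_tendsto:
  fixes q c d :: complex
  assumes q: "q \<noteq> 0" and la: "is_partition la" and mu: "is_partition mu" and le: "mu \<le> la"
  shows "((\<lambda>a::real. sigma_qM la mu q (of_real a) c d) \<longlongrightarrow> sigma_ASC la mu q c d) (at 0 within S)"
proof -
  let ?L = "plen la" and ?E = "n_exponent la mu"
  define D where "D = psize la - psize mu"
  define C where "C = c powi (- int (psize la)) * (1 / (q * d)) ^ D * q powi (2 * ?E)"
  let ?R = "\<Sum>p | p permutes {..<?L}. of_int (sign p) * (\<Prod>j<?L. ASC_entry la mu q j (p j))"
  have lim: "((\<lambda>a::real. C * (\<Sum>p | p permutes {..<?L}. of_int (sign p) *
      (of_real a ^ D * (\<Prod>j<?L. qM_entry la mu q (c / of_real a) j (p j))))) \<longlongrightarrow>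
    C * (\<Sum>p | p permutes {..<?L}. of_int (sign p) *
      ((- c) ^ D * q powi (int D - ?E) * (\<Prod>j<?L. ASC_entry la mu q j (p j))))) (at 0 within S)"
    unfolding D_def by (intro tendsto_intros prod_qM_entry_tendsto q la mu le) simp
  have qM: "sigma_qM la mu q (of_real a) c d = C * (\<Sum>p | p permutes {..<?L}. of_int (sign p) *
      (of_real a ^ D * (\<Prod>j<?L. qM_entry la mu q (c / of_real a) j (p j))))" for a :: real
  proof -
    have "(of_real a / (q * d)) ^ D = (1 / (q * d)) ^ D * of_real a ^ D"
      by (simp add: power_divide)
    moreover have "(\<Sum>p | p permutes {..<?L}. of_int (sign p) *
        (of_real a ^ D * (\<Prod>j<?L. qM_entry la mu q (c / of_real a) j (p j)))) =
      of_real a ^ D * (\<Sum>p | p permutes {..<?L}. of_int (sign p) *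
        (\<Prod>j<?L. qM_entry la mu q (c / of_real a) j (p j)))"
      by (simp only: sum_distrib_left mult.left_commute)
    ultimately show ?thesis
      unfolding sigma_qM_def qM_entry_def[symmetric] det_leibniz C_def D_def
      by (simp only: mult_ac)
  qed
  have "C * (\<Sum>p | p permutes {..<?L}. of_int (sign p) *
      ((- c) ^ D * q powi (int D - ?E) * (\<Prod>j<?L. ASC_entry la mu q j (p j))))
    = C * ((- c) ^ D * q powi (int D - ?E)) * ?R"
    by (simp only: sum_distrib_left mult_ac)
  also have pw: "q powi (int D - ?E) = q ^ D * q powi (- ?E)"
    using q by (simp add: power_int_diff power_int_minus divide_inverse)
  also have "C * ((- c) ^ D * (q ^ D * q powi (- ?E))) * ?R =
    c powi (- int (psize la)) * ((1 / (q * d)) ^ D * ((- c) ^ D * q ^ D)) *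
      (q powi (2 * ?E) * q powi (- ?E)) * ?R"
    by (simp only: C_def mult_ac)
  also have "(1 / (q * d)) ^ D * ((- c) ^ D * q ^ D) = (1 / (q * d) * (- c * q)) ^ D"
    by (simp only: power_mult_distrib)
  \<comment> \<open>For \<open>d = 0\<close> both sides are \<open>0\<close> by the convention for
    division.\<close>
  also have "1 / (q * d) * (- c * q) = - c / d"
    using q by (cases "d = 0") (simp_all add: field_simps)
  also have "q powi (2 * ?E) * q powi (- ?E) = q powi ?E"
    using q by (simp flip: power_int_add)
  also have "c powi (- int (psize la)) * (- c / d) ^ D * q powi ?E * ?R = sigma_ASC la mu q c d"
    unfolding sigma_ASC_def ASC_entry_def[symmetric] det_leibniz D_def ..
  finally show ?thesis using lim unfolding pw by (simp only: qM)
qed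

section \<open>Convergence of the two families in Sym\<close>

lemma Sym_upto_sum_scale:
  assumes "\<And>i. i \<in> S \<Longrightarrow> f i \<in> Sym_upto D"
  shows "(\<lambda>m. \<Sum>i\<in>S. a i * scale_vars c (f i) m) \<in> Sym_upto D"
  unfolding Sym_upto_def
proof (intro CollectI conjI allI impI)
  fix m assume "(\<Sum>i\<in>S. a i * scale_vars c (f i) m) \<noteq> 0"
  then obtain i where "i \<in> S" "a i * scale_vars c (f i) m \<noteq> 0" by (meson sum.neutral)
  then show "mdeg m \<le> D" using assms[of i] by (auto simp: scale_vars_def Sym_upto_def)
next
  fix p :: "nat \<Rightarrow> nat" and m assume "bij p"
  \<comment> \<open>Scaling multiplies a coefficient by a power depending only on the degree, which
    renaming preserves.\<close>
  then show "(\<Sum>i\<in>S. a i * scale_vars c (f i) (Poly_Mapping.map_key p m)) = (\<Sum>i\<in>S. a i * scale_vars c (f i) m)"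
    using assms by (intro sum.cong) (auto simp: scale_vars_def Sym_upto_def mdeg_map_key)
qed

theorem theorem6p4:
  fixes q :: real and c d :: complex and la :: "nat \<Rightarrow> nat"
  assumes "0 < q" and "q < 1"
    and "admissible_pair q c d"
    and "is_partition la"
  shows "limitin (Sym_top (psize la))
           (\<lambda>a::real. Phi_qM la (complex_of_real q) (complex_of_real a) c d)
           (Phi_ASC la (complex_of_real q) c d)
           (at 0 within admissible_a q c d)"
proof -
  have q: "complex_of_real q \<noteq> 0" "norm (complex_of_real q) < 1" using assms by auto
  \<comment> \<open>Containment of diagrams bounds |mu| by |la|, so all summands lie in one
    space.\<close>
  have I: "I_A (complex_of_real q) mu \<in> Sym_upto (psize la)"
    if "mu \<in> {mu. is_partition mu \<and> mu \<le> la}" for mu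
  proof -
    have mu: "is_partition mu" "mu \<le> la" using that by auto
    have "psize mu \<le> psize la"
      using mu(2) by (auto simp: psize_eq_sum[OF mu(1) plen_mono[OF assms(4) mu(2)]]
          psize_eq_sum[OF assms(4) order_refl] le_fun_def intro: sum_mono)
    then show ?thesis using I_A_in_Sym_upto[OF mu(1) q] Sym_upto_mono by blast
  qed
  have "Phi_qM la (complex_of_real q) a c d \<in> Sym_upto (psize la)" for a
    unfolding Phi_qM_def using I by (rule Sym_upto_sum_scale)
  moreover have "Phi_ASC la (complex_of_real q) c d \<in> Sym_upto (psize la)"
    unfolding Phi_ASC_def using I by (rule Sym_upto_sum_scale)
  \<comment> \<open>Only the \<open>sigma\<close> factors depend on \<open>a\<close>, so each
    coefficient converges termwise in the sum over \<open>mu\<close>.\<close>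
  moreover have "((\<lambda>a::real. Phi_qM la (complex_of_real q) (complex_of_real a) c d m) \<longlongrightarrow>
    Phi_ASC la (complex_of_real q) c d m) (at 0 within admissible_a q c d)" for m
    unfolding Phi_qM_def Phi_ASC_def
    by (intro tendsto_intros sigma_qM_tendsto q assms(4)) auto
  ultimately show ?thesis by (simp add: limitin_Sym_top)
qed

end
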